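(* The model checking problem for PHL is undecidable: there is no algorithm that, given a finite Markov decision process $M$ (with rational transition probabilities) and a closed well-formed PHL formula $\Phi$, decides whether $M \models \Phi$.
   Context: A Markov decision process (MDP) is a tuple $M=(S,\mathit{Act},\mathbf{P},\iota,\mathsf{AP},L)$ with finite state set $S$, finite action set $\mathit{Act}$, transition function $\mathbf{P}:S\times\mathit{Act}\times S\to[0,1]$ with $\sum_{s'}\mathbf{P}(s,a,s')\in\{0,1\}$ for all $s,a$ (action $a$ is enabled in $s$ if this sum is $1$), initial distribution $\iota$ on $S$, finite set of atomic propositions $\mathsf{AP}$ and labelling $L:S\to 2^{\mathsf{AP}}$. A scheduler is a function $\mathfrak{S}:(S\cdot\mathit{Act})^*S\to\mathcal{D}(\mathit{Act})$ (distributions over actions) whose support at each history consists of actions enabled in the last state; $\mathit{Sched}(M)$ is the set of all schedulers. A scheduler induces a Markov chain $M_{\mathfrak S}$ on histories with $\mathbf{P}_{\mathfrak S}(h,h\cdot s')=\sum_a\mathfrak{S}(h)(a)\mathbf{P}(s_n,a,s')$ ($s_n$ the last state of $h$), initial distribution $\iota$, and label of $h$ equal to $L(s_n)$; the usual cylinder-set probability measure on infinite paths is used. The $n$-self-composition $M^n$ has states $S^n$, actions $\mathit{Act}^n$, $\widehat{\mathbf{P}}((s_i)_i,(a_i)_i,(s'_i)_i)=\prod_i\mathbf{P}(s_i,a_i,s'_i)$, initial distribution $\widehat\iota((s,\dots,s))=\iota(s)$ and $0$ off the diagonal, and labels $(L(s_1),\dots,L(s_n))$. Schedulers $\mathfrak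 S_1,\dots,\mathfrak S_n$ for $M$ compose into the scheduler $\mathfrak S_1\|\cdots\|\mathfrak S_n$ for $M^n$ choosing $(a_1,\dots,a_n)$ with probability $\prod_i\mathfrak S_i(h_i)(a_i)$, where $h_i$ is the $i$-th component history. PHL syntax (with scheduler variables $\sigma$ and path variables $\pi$, each path variable associated with a scheduler variable, written $\pi:\sigma$): $\Phi::=\forall\sigma.\Phi\mid\Phi\wedge\Phi\mid\neg\Phi\mid\chi\mid P\bowtie c$, where $\bowtie\in\{<,\le,>,\ge\}$, $c\in\mathbb{Q}$; $\chi::=a_\pi\mid\chi\wedge\chi\mid\neg\chi\mid\bigcirc\chi\mid\chi\,\mathcal{U}\,\chi\mid\forall\pi:\sigma.\chi$ (HyperCTL$^*$ formulas); $P::=\mathbb{P}(\varphi)\mid P+P\mid c\cdot P$; $\varphi::=a_\sigma\mid\varphi\wedge\varphi\mid\neg\varphi\mid\bigcirc\varphi\mid\varphi\,\mathcal{U}\,\varphi$ (LTL over indexed propositions), with $a\in\mathsf{AP}$. Existential quantifiers and the other Boolean/temporal operators are derived as usual. A formula is well-formed if each quantifier $\forall\pi:\sigma$ lies in the scope of a quantifier over $\sigma$, and closed if all variables are bound. Semantics: a scheduler assignment $\Sigma$ is a finite sequence $((\sigma_1,\mathfrak S_1),\dots,(\sigma_m,\mathfrak S_m))$, $\Sigma(\sigma)$ being the scheduler at the last position with variable $\sigma$, and $\Sigma[\sigma\mapsto\mathfrak S]$ appends a pair; $M_\Sigma$ is the Markov chain induced on $M^m$ by $\mathfrak S_1\|\cdots\|\mathfrak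 S_m$. $M,\Sigma\models\forall\sigma.\Phi$ iff $M,\Sigma[\sigma\mapsto\mathfrak S]\models\Phi$ for all $\mathfrak S\in\mathit{Sched}(M)$; Boolean connectives as usual; $M,\Sigma\models\chi$ iff $M,\Sigma,\Pi_\emptyset\models\chi$ for the empty path assignment; $M,\Sigma\models P\bowtie c$ iff $[\![P]\!]_{M_\Sigma}\bowtie c$, where $[\![\mathbb{P}(\varphi)]\!]_C$ is the probability in $C$ of the set of infinite paths satisfying $\varphi$, $[\![P_1+P_2]\!]=[\![P_1]\!]+[\![P_2]\!]$, $[\![cP]\!]=c[\![P]\!]$, and $a_\sigma$ holds at a state of $M_\Sigma$ iff $a$ belongs to the label component of the last position of $\Sigma$ carrying $\sigma$ (LTL operators interpreted as usual). Path assignments $\Pi$ are finite sequences of (path variable, infinite path of $M$) pairs, with $\Pi[j,\infty]$ shifting all paths by $j$; $M,\Sigma,\Pi\models a_\pi$ iff $a\in L(\Pi(\pi)[0])$; $\bigcirc$, $\mathcal{U}$ and Boolean operators are interpreted synchronously on all paths of $\Pi$; $M,\Sigma,\Pi\models\forall\pi:\sigma.\chi$ iff $M,\Sigma,\Pi[\pi\mapsto\rho]\models\chi$ for every infinite path $\rho$ of $C$, where $C=M_{\Sigma(\sigma)}$ if $\Pi$ is empty, and otherwise $C$ is $M_{\Sigma(\sigma)}$ started in the first state of the path assigned to the most recently added path variable associated with $\sigma$. $M\models\Phi$ iff $M,\Sigma_\emptyset\models\Phi$ for the empty scheduler assignment. *)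

theory Defs
  imports "HOL-Probability.Probability" "HOL-Library.Nat_Bijection"
begin

section \<open>Partial recursive functions\<close>

datatype recf = Zero | Succ | Proj nat | Comp recf "recf list" | PrimRec recf recf | Mu recf

text \<open>\<open>rec_eval f xs y\<close>: evaluating \<open>f\<close> on the arguments \<open>xs\<close> terminates with result \<open>y\<close>.\<close>

inductive rec_eval :: "recf \<Rightarrow> nat list \<Rightarrow> nat \<Rightarrow> bool" where
  Zero: "rec_eval Zero xs 0"
| Succ: "rec_eval Succ [x] (Suc x)"
| Proj: "i < length xs \<Longrightarrow> rec_eval (Proj i) xs (xs ! i)"
| Comp: "length ys = length gs \<Longrightarrow> (\<And>i. i < length gs \<Longrightarrow> rec_eval (gs ! i) xs (ys ! i)) \<Longrightarrow>
    rec_eval f ys z \<Longrightarrow> rec_eval (Comp f gs) xs z"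
| PrimRec_0: "rec_eval f xs y \<Longrightarrow> rec_eval (PrimRec f g) (0 # xs) y"
| PrimRec_Suc: "rec_eval (PrimRec f g) (n # xs) r \<Longrightarrow> rec_eval g (n # r # xs) y \<Longrightarrow>
    rec_eval (PrimRec f g) (Suc n # xs) y"
| Mu: "rec_eval f (n # xs) 0 \<Longrightarrow> (\<And>i. i < n \<Longrightarrow> \<exists>y. rec_eval f (i # xs) (Suc y)) \<Longrightarrow>
    rec_eval (Mu f) xs n"

inductive_cases rec_eval_elims:
  "rec_eval Zero xs z" "rec_eval Succ xs z" "rec_eval (Proj i) xs z" "rec_eval (Comp f gs) xs z"
  "rec_eval (PrimRec f g) (0 # xs) z" "rec_eval (PrimRec f g) (Suc n # xs) z" "rec_eval (Mu f) xs z"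

lemma rec_eval_deterministic: "rec_eval f xs y \<Longrightarrow> rec_eval f xs z \<Longrightarrow> y = z"
proof (induction arbitrary: z rule: rec_eval.induct)
  case (Comp ys gs xs f z z')
  from Comp.prems obtain ys' where *: "length ys' = length gs"
    "\<And>i. i < length gs \<Longrightarrow> rec_eval (gs ! i) xs (ys' ! i)" "rec_eval f ys' z'"
    by (elim rec_eval_elims(4)) blast
  have "ys = ys'"
    using Comp.IH(1) *(1,2) Comp.hyps(1) by (intro nth_equalityI) auto
  with *(3) Comp.IH(2) show ?case by auto
next
  case (PrimRec_Suc f g n xs r y)
  from PrimRec_Suc.prems obtain r' where "rec_eval (PrimRec f g) (n # xs) r'"
    "rec_eval g (n # r' # xs) z"
    by (elim rec_eval_elims(6)) blast
  with PrimRec_Suc.IH show ?case by auto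
next
  case (Mu f n xs)
  have z: "rec_eval f (z # xs) 0"
    using Mu.prems by (rule rec_eval_elims(7))
  have below_z: "\<exists>y. rec_eval f (i # xs) (Suc y)" if "i < z" for i
    using Mu.prems that by (elim rec_eval_elims(7)) blast
  have "\<not> n < z" using Mu.IH(1) below_z by fastforce
  moreover have "\<not> z < n" using Mu.IH(2) z by fastforce
  ultimately show ?case by simp
next
  case (PrimRec_0 f xs y g)
  from PrimRec_0.prems have "rec_eval f xs z"
    by (elim rec_eval_elims(5)) blast
  with PrimRec_0.IH show ?case .
qed (auto elim: rec_eval_elims(1-3))

text \<open>
  Algorithmic decidability of the property \<open>P\<close> for inputs from \<open>I\<close>, presented through the
  encoding \<open>code\<close>.  The algorithm may behave arbitrarily on numbers that encode no input.
\<close>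

definition decidable_on :: "'i set \<Rightarrow> ('i \<Rightarrow> nat) \<Rightarrow> ('i \<Rightarrow> bool) \<Rightarrow> bool" where
  "decidable_on I code P \<longleftrightarrow>
    (\<exists>f. \<forall>x\<in>I. rec_eval f [code x] (if P x then 1 else 0))"


section \<open>Markov chains\<close>

record ('h, 'l) chain =
  start :: "'h pmf"
  step :: "'h \<Rightarrow> 'h pmf"
  clabel :: "'h \<Rightarrow> 'l"

definition chain_paths :: "('h, 'l) chain \<Rightarrow> (nat \<Rightarrow> 'h) set" where
  "chain_paths C =
    {\<omega>. \<omega> 0 \<in> set_pmf (start C) \<and> (\<forall>i. \<omega> (Suc i) \<in> set_pmf (step C (\<omega> i)))}"

definition cylinder :: "'h list \<Rightarrow> (nat \<Rightarrow> 'h) set" where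
  "cylinder hs = {\<omega>. \<forall>i<length hs. \<omega> i = hs ! i}"

definition cylinder_prob :: "('h, 'l) chain \<Rightarrow> 'h list \<Rightarrow> real" where
  "cylinder_prob C hs =
    pmf (start C) (hs ! 0) * (\<Prod>i<length hs - 1. pmf (step C (hs ! i)) (hs ! Suc i))"

definition path_measure :: "('h::countable, 'l) chain \<Rightarrow> (nat \<Rightarrow> 'h) measure" where
  "path_measure C =
    extend_measure UNIV {hs. hs \<noteq> []} cylinder (\<lambda>hs. ennreal (cylinder_prob C hs))"

text \<open>The measure required by \<^const>\<open>extend_measure\<close> exists, by the Ionescu-Tulcea theorem.\<close>

lemma emeasure_path_measure_cylinder:
  fixes C :: "('h::countable, 'l) chain"
  assumes "hs \<noteq> []"
  shows "emeasure (path_measure C) (cylinder hs) = ennreal (cylinder_prob C hs)"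
proof -
  define q where "q n \<omega> = (if n = 0 then start C else step C (\<omega> (n - 1)))"
    for n :: nat and \<omega> :: "nat \<Rightarrow> 'h"
  define P where "P n \<omega> = measure_pmf (q n \<omega>)" for n \<omega>
  define M where "M = (\<lambda>_ :: nat. count_space (UNIV :: 'h set))"
  have PiM_eq: "PiM J M = count_space (PiE J (\<lambda>_. UNIV))" if "finite J" for J
    using that unfolding M_def by (intro count_space_PiM_finite) auto
  interpret IT: Ionescu_Tulcea P M
  proof (rule Ionescu_Tulcea.intro)
    show "P i \<in> measurable (PiM {0..<i} M) (subprob_algebra (M i))" for i
      unfolding PiM_eq[OF finite_atLeastLessThan] measurable_count_space_eq1
      by (auto simp: P_def M_def space_subprob_algebra intro: measure_pmf.subprob_space_axioms)
    show "prob_space (P i x)" for i x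
      by (simp add: P_def measure_pmf.prob_space_axioms)
  qed
  have undef: "(\<lambda>_. undefined) \<in> space (PiM {0..<0} M)"
    by (simp add: space_PiM)
  have sets_C: "sets (IT.C 0 n (\<lambda>_. undefined)) = sets (PiM {0..<n} M)" for n
    using IT.sets_C[OF undef, of n] by simp
  have C_point: "emeasure (IT.C 0 n (\<lambda>_. undefined)) {restrict w {0..<n}} =
      ennreal (\<Prod>i<n. pmf (q i w) (w i))" for n and w :: "nat \<Rightarrow> 'h"
  proof (induction n)
    case 0
    show ?case by (simp add: PiM_eq restrict_def)
  next
    case (Suc n)
    let ?x = "restrict w {0..<n}" and ?y = "restrict w {0..<Suc n}"
    have y: "{?y} \<in> sets (PiM {0..<Suc n} M)"
      by (simp add: PiM_eq)
    have eP: "emeasure (IT.eP n x) {?y} = ennreal (pmf (q n w) (w n)) * indicator {?x} x"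
      if x: "x \<in> space (PiM {0..<n} M)" for x
    proof -
      have ext: "x \<in> extensional {0..<n}"
        using x by (simp add: space_PiM PiE_def)
      have "(\<lambda>v. fun_upd x n v) -` {?y} = (if x = ?x then {w n} else {})"
      proof (intro set_eqI iffI)
        fix v assume "v \<in> (\<lambda>v. fun_upd x n v) -` {?y}"
        then have upd: "x(n := v) = ?y" by simp
        have "v = w n" using fun_cong[OF upd, of n] by simp
        moreover have "x = ?x"
        proof (rule extensionalityI[OF ext])
          show "x i = ?x i" if "i \<in> {0..<n}" for i
            using fun_cong[OF upd, of i] that by (simp split: if_splits)
        qed simp
        ultimately show "v \<in> (if x = ?x then {w n} else {})" by simp
      next
        fix v assume "v \<in> (if x = ?x then {w n} else {})"
        then have "x = ?x" "v = w n" by (auto split: if_splits)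
        then show "v \<in> (\<lambda>v. fun_upd x n v) -` {?y}"
          by (auto simp: fun_eq_iff restrict_def)
      qed
      moreover have "q n ?x = q n w"
        by (cases n) (auto simp: q_def)
      ultimately show ?thesis
        using x y by (subst IT.emeasure_eP) (auto simp: P_def M_def emeasure_pmf_single)
    qed
    have "emeasure (IT.C 0 (Suc n) (\<lambda>_. undefined)) {?y} =
        (\<integral>\<^sup>+x. emeasure (IT.eP n x) {?y} \<partial>IT.C 0 n (\<lambda>_. undefined))"
      unfolding IT.C.simps add_0
    proof (rule emeasure_bind[OF _ _ y])
      show "space (IT.C 0 n (\<lambda>_. undefined)) \<noteq> {}"
        using IT.prob_space_C[OF undef] by (rule prob_space.not_empty)
      show "IT.eP n \<in> measurable (IT.C 0 n (\<lambda>_. undefined)) (subprob_algebra (PiM {0..<Suc n} M))"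
        by (subst measurable_cong_sets[OF sets_C refl]) (rule IT.measurable_eP)
    qed
    also have "\<dots> = (\<integral>\<^sup>+x. ennreal (pmf (q n w) (w n)) * indicator {?x} x
        \<partial>IT.C 0 n (\<lambda>_. undefined))"
      using IT.space_C[OF undef, of n] by (intro nn_integral_cong eP) simp
    also have "\<dots> = ennreal (pmf (q n w) (w n)) * emeasure (IT.C 0 n (\<lambda>_. undefined)) {?x}"
      by (rule nn_integral_cmult_indicator) (simp add: sets_C PiM_eq)
    also have "\<dots> = ennreal (\<Prod>i<Suc n. pmf (q i w) (w i))"
      by (simp add: Suc.IH ennreal_mult' prod_nonneg mult.commute)
    finally show ?case .
  qed
  let ?lim = "IT.PF.lim"
  have emb: "cylinder gs = prod_emb UNIV M {0..<length gs} {restrict (nth gs) {0..<length gs}}"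
    for gs
  proof -
    have "restrict \<omega> {0..<length gs} = restrict (nth gs) {0..<length gs} \<longleftrightarrow>
        (\<forall>i<length gs. \<omega> i = gs ! i)" for \<omega>
      by (metis (mono_tags, lifting) atLeastLessThan_iff le0 restrict_apply' restrict_ext)
    then show ?thesis
      by (auto simp: cylinder_def prod_emb_def M_def)
  qed
  have sets_cyl: "cylinder gs \<in> sets ?lim" for gs
    unfolding emb IT.PF.sets_lim by (rule measurable_prod_emb) (auto simp: PiM_eq)
  have lim: "emeasure ?lim (cylinder gs) = ennreal (cylinder_prob C gs)" if "gs \<noteq> []" for gs
  proof -
    let ?n = "length gs" and ?X = "{restrict (nth gs) {0..<length gs}}"
    from that obtain m where m: "?n = Suc m" by (cases gs) auto
    have X: "?X \<in> sets (PiM {0..<?n} M)" by (simp add: PiM_eq)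
    have "emeasure ?lim (cylinder gs) = emeasure (IT.CI {0..<?n}) ?X"
      unfolding emb by (rule IT.lim[OF _ X]) simp
    also have "\<dots> = emeasure (IT.C 0 ?n (\<lambda>_. undefined)) ?X"
      using IT.emeasure_CI[OF subset_refl X] prod_emb_id[of ?X "{0..<?n}" M]
      by (simp add: M_def)
    also have "\<dots> = ennreal (\<Prod>i<?n. pmf (q i (nth gs)) (gs ! i))"
      by (rule C_point)
    also have "(\<Prod>i<?n. pmf (q i (nth gs)) (gs ! i)) = cylinder_prob C gs"
      unfolding m prod.lessThan_Suc_shift by (simp add: cylinder_prob_def q_def m)
    finally show ?thesis .
  qed
  have sub: "sets (path_measure C) \<subseteq> sets ?lim"
  proof -
    have "sets (path_measure C) = sigma_sets UNIV (cylinder ` {hs. hs \<noteq> []})"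
      unfolding path_measure_def by (rule sets_extend_measure) simp
    also have "\<dots> \<subseteq> sets ?lim"
    proof -
      have "space ?lim = UNIV"
        unfolding IT.PF.space_lim by (simp add: space_PiM M_def)
      then show ?thesis
        using sets.sigma_sets_subset[of "cylinder ` {hs. hs \<noteq> []}" ?lim] sets_cyl by fastforce
    qed
    finally show ?thesis .
  qed
  show ?thesis
  proof (rule emeasure_extend_measure[OF path_measure_def])
    show "positive (sets (path_measure C)) (emeasure ?lim)"
      by (simp add: positive_def)
    show "countably_additive (sets (path_measure C)) (emeasure ?lim)"
      unfolding countably_additive_def
      by (intro allI impI suminf_emeasure) (use sub in blast)+
  qed (use assms lim in auto)
qed


section \<open>Markov decision processes\<close>

record ('s, 'a, 'l) mdp =
  states :: "'s set"
  actions :: "'a set"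
  tprob :: "'s \<Rightarrow> 'a \<Rightarrow> 's \<Rightarrow> real"
  iprob :: "'s \<Rightarrow> real"
  label :: "'s \<Rightarrow> 'l"

definition is_mdp :: "'p set \<Rightarrow> ('s, 'a, 'p set) mdp \<Rightarrow> bool" where
  "is_mdp AP M \<longleftrightarrow>
    finite (states M) \<and> finite (actions M) \<and> finite AP \<and>
    (\<forall>s a s'. 0 \<le> tprob M s a s' \<and> tprob M s a s' \<le> 1) \<and>
    (\<forall>s a s'. tprob M s a s' \<noteq> 0 \<longrightarrow> s \<in> states M \<and> a \<in> actions M \<and> s' \<in> states M) \<and>
    (\<forall>s\<in>states M. \<forall>a\<in>actions M. (\<Sum>s'\<in>states M. tprob M s a s') \<in> {0, 1}) \<and>
    (\<forall>s. 0 \<le> iprob M s) \<and> (\<forall>s. iprob M s \<noteq> 0 \<longrightarrow> s \<in> states M) \<and>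
    (\<Sum>s\<in>states M. iprob M s) = 1 \<and>
    (\<forall>s\<in>states M. label M s \<subseteq> AP)"

definition enabled :: "('s, 'a, 'l) mdp \<Rightarrow> 's \<Rightarrow> 'a set" where
  "enabled M s = {a \<in> actions M. (\<Sum>s'\<in>states M. tprob M s a s') = 1}"

text \<open>The history \<open>s\<^sub>0 a\<^sub>0 s\<^sub>1 a\<^sub>1 \<dots> s\<^sub>n\<close> is \<open>([(s\<^sub>0, a\<^sub>0), \<dots>, (s\<^sub>n\<^sub>-\<^sub>1, a\<^sub>n\<^sub>-\<^sub>1)], s\<^sub>n)\<close>.\<close>

type_synonym ('s, 'a) hist = "('s \<times> 'a) list \<times> 's"
type_synonym ('s, 'a) sched = "('s, 'a) hist \<Rightarrow> 'a pmf"

abbreviation last_state :: "('s, 'a) hist \<Rightarrow> 's" where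
  "last_state \<equiv> snd"

definition extend_hist :: "('s, 'a) hist \<Rightarrow> 'a \<Rightarrow> 's \<Rightarrow> ('s, 'a) hist" where
  "extend_hist h a s' = (fst h @ [(snd h, a)], s')"

definition histories :: "('s, 'a, 'l) mdp \<Rightarrow> ('s, 'a) hist set" where
  "histories M = lists (states M \<times> actions M) \<times> states M"

definition Sched :: "('s, 'a, 'l) mdp \<Rightarrow> ('s, 'a) sched set" where
  "Sched M = {\<SS>. \<forall>h\<in>histories M. set_pmf (\<SS> h) \<subseteq> enabled M (last_state h)}"

text \<open>
  Schedulers read actions, so a step of the induced chain records the chosen action along with
  the successor state.  Its probability is \<open>\<SS>(h)(a) \<cdot> P(s\<^sub>n, a, s')\<close>, and summing over
  \<open>a\<close> gives the probability of moving from \<open>h\<close> to the state \<open>s'\<close>.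
\<close>

definition induced :: "('s, 'a, 'l) mdp \<Rightarrow> ('s, 'a) sched \<Rightarrow> (('s, 'a) hist, 'l) chain" where
  "induced M \<SS> =
    \<lparr>start = map_pmf (\<lambda>s. ([], s)) (embed_pmf (iprob M)),
     step = (\<lambda>h. bind_pmf (\<SS> h)
       (\<lambda>a. map_pmf (extend_hist h a) (embed_pmf (tprob M (last_state h) a)))),
     clabel = (\<lambda>h. label M (last_state h))\<rparr>"

lemma pmf_embed_pmf_finite:
  assumes "finite S" "\<And>x. 0 \<le> f x" "\<And>x. f x \<noteq> 0 \<Longrightarrow> x \<in> S" "sum f S = 1"
  shows "pmf (embed_pmf f) x = f x"
proof (rule pmf_embed_pmf)
  have "(\<integral>\<^sup>+x. ennreal (f x) \<partial>count_space UNIV) = (\<Sum>x\<in>S. ennreal (f x))"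
    using assms by (intro nn_integral_count_space') auto
  also have "\<dots> = 1"
    using assms by (simp add: sum_ennreal)
  finally show "(\<integral>\<^sup>+x. ennreal (f x) \<partial>count_space UNIV) = 1" .
qed (use assms in auto)

lemma pmf_step_induced:
  assumes "is_mdp AP M" "last_state h \<in> states M" "a \<in> enabled M (last_state h)"
  shows "pmf (step (induced M \<SS>) h) (extend_hist h a s') =
    pmf (\<SS> h) a * tprob M (last_state h) a s'"
proof -
  let ?t = "\<lambda>b. embed_pmf (tprob M (last_state h) b)"
  have "pmf (map_pmf (extend_hist h b) (?t b)) (extend_hist h a s') =
      indicat_real {a} b * pmf (?t a) s'" for b
  proof (cases "b = a")
    case True
    have "inj (extend_hist h a)" by (auto simp: inj_def extend_hist_def)
    then show ?thesis using True by (simp add: pmf_map_inj')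
  next
    case False
    then have "extend_hist h a s' \<notin> extend_hist h b ` set_pmf (?t b)" by (auto simp: extend_hist_def)
    then show ?thesis using False by (simp add: pmf_map_outside)
  qed
  then have "pmf (step (induced M \<SS>) h) (extend_hist h a s') = pmf (\<SS> h) a * pmf (?t a) s'"
    by (simp add: induced_def pmf_bind measure_pmf_single)
  also have "pmf (?t a) s' = tprob M (last_state h) a s'"
    using assms by (intro pmf_embed_pmf_finite[of "states M"]) (auto simp: is_mdp_def enabled_def)
  finally show ?thesis .
qed

definition self_comp :: "nat \<Rightarrow> ('s, 'a, 'l) mdp \<Rightarrow> ('s list, 'a list, 'l list) mdp" where
  "self_comp n M =
    \<lparr>states = {ss. length ss = n \<and> set ss \<subseteq> states M},
     actions = {as. length as = n \<and> set as \<subseteq> actions M},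
     tprob = (\<lambda>ss as ss'. if length ss = n \<and> length as = n \<and> length ss' = n
       then \<Prod>i<n. tprob M (ss ! i) (as ! i) (ss' ! i) else 0),
     iprob = (\<lambda>ss. \<Sum>s\<in>states M. if ss = replicate n s then iprob M s else 0),
     label = map (label M)\<rparr>"

definition comp_hist :: "nat \<Rightarrow> ('s list, 'a list) hist \<Rightarrow> ('s, 'a) hist" where
  "comp_hist i h = (map (\<lambda>(ss, as). (ss ! i, as ! i)) (fst h), snd h ! i)"

definition par_sched :: "('s, 'a) sched list \<Rightarrow> ('s list, 'a list) sched" where
  "par_sched \<SS>s h =
    map_pmf (\<lambda>f. map f [0..<length \<SS>s])
      (Pi_pmf {..<length \<SS>s} undefined (\<lambda>i. (\<SS>s ! i) (comp_hist i h)))"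


section \<open>Syntax of PHL\<close>

type_synonym svar = nat

text \<open>Every path variable carries the scheduler variable it is associated with.\<close>

datatype pvar = PVar (pname: nat) (psched: svar)

datatype (hctl_aps: 'p) hctl =
    HAtom 'p pvar
  | HAnd "'p hctl" "'p hctl"
  | HNot "'p hctl"
  | HNext "'p hctl"
  | HUntil "'p hctl" "'p hctl"
  | HAll pvar "'p hctl"

datatype (ltl_aps: 'p) ltl =
    LAtom 'p svar
  | LAnd "'p ltl" "'p ltl"
  | LNot "'p ltl"
  | LNext "'p ltl"
  | LUntil "'p ltl" "'p ltl"

datatype (pexp_aps: 'p) pexp =
    Prob "'p ltl"
  | Plus "'p pexp" "'p pexp"
  | Scale rat "'p pexp"

datatype cmp = Lt | Le | Gt | Ge

datatype (phl_aps: 'p) phl =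
    PAll svar "'p phl"
  | PAnd "'p phl" "'p phl"
  | PNot "'p phl"
  | PHyper "'p hctl"
  | PCmp "'p pexp" cmp rat

primrec hctl_scheds :: "'p hctl \<Rightarrow> svar set" where
  "hctl_scheds (HAtom a \<pi>) = {}"
| "hctl_scheds (HAnd \<xi> \<psi>) = hctl_scheds \<xi> \<union> hctl_scheds \<psi>"
| "hctl_scheds (HNot \<xi>) = hctl_scheds \<xi>"
| "hctl_scheds (HNext \<xi>) = hctl_scheds \<xi>"
| "hctl_scheds (HUntil \<xi> \<psi>) = hctl_scheds \<xi> \<union> hctl_scheds \<psi>"
| "hctl_scheds (HAll \<pi> \<xi>) = insert (psched \<pi>) (hctl_scheds \<xi>)"

primrec hctl_free :: "'p hctl \<Rightarrow> pvar set" where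
  "hctl_free (HAtom a \<pi>) = {\<pi>}"
| "hctl_free (HAnd \<xi> \<psi>) = hctl_free \<xi> \<union> hctl_free \<psi>"
| "hctl_free (HNot \<xi>) = hctl_free \<xi>"
| "hctl_free (HNext \<xi>) = hctl_free \<xi>"
| "hctl_free (HUntil \<xi> \<psi>) = hctl_free \<xi> \<union> hctl_free \<psi>"
| "hctl_free (HAll \<pi> \<xi>) = hctl_free \<xi> - {\<pi>}"

primrec ltl_scheds :: "'p ltl \<Rightarrow> svar set" where
  "ltl_scheds (LAtom a \<sigma>) = {\<sigma>}"
| "ltl_scheds (LAnd \<phi> \<psi>) = ltl_scheds \<phi> \<union> ltl_scheds \<psi>"
| "ltl_scheds (LNot \<phi>) = ltl_scheds \<phi>"
| "ltl_scheds (LNext \<phi>) = ltl_scheds \<phi>"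
| "ltl_scheds (LUntil \<phi> \<psi>) = ltl_scheds \<phi> \<union> ltl_scheds \<psi>"

primrec pexp_scheds :: "'p pexp \<Rightarrow> svar set" where
  "pexp_scheds (Prob \<phi>) = ltl_scheds \<phi>"
| "pexp_scheds (Plus P Q) = pexp_scheds P \<union> pexp_scheds Q"
| "pexp_scheds (Scale c P) = pexp_scheds P"

primrec free_svars :: "'p phl \<Rightarrow> svar set" where
  "free_svars (PAll \<sigma> \<Phi>) = free_svars \<Phi> - {\<sigma>}"
| "free_svars (PAnd \<Phi> \<Psi>) = free_svars \<Phi> \<union> free_svars \<Psi>"
| "free_svars (PNot \<Phi>) = free_svars \<Phi>"
| "free_svars (PHyper \<xi>) = hctl_scheds \<xi>"
| "free_svars (PCmp P r c) = pexp_scheds P"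

primrec free_pvars :: "'p phl \<Rightarrow> pvar set" where
  "free_pvars (PAll \<sigma> \<Phi>) = free_pvars \<Phi>"
| "free_pvars (PAnd \<Phi> \<Psi>) = free_pvars \<Phi> \<union> free_pvars \<Psi>"
| "free_pvars (PNot \<Phi>) = free_pvars \<Phi>"
| "free_pvars (PHyper \<xi>) = hctl_free \<xi>"
| "free_pvars (PCmp P r c) = {}"

definition closed_phl :: "'p phl \<Rightarrow> bool" where
  "closed_phl \<Phi> \<longleftrightarrow> free_svars \<Phi> = {} \<and> free_pvars \<Phi> = {}"

text \<open>\<open>quantifiers_scoped V \<Phi>\<close>: \<open>\<Phi>\<close> is well-formed in the scope of quantifiers over \<open>V\<close>.\<close>

primrec quantifiers_scoped :: "svar set \<Rightarrow> 'p phl \<Rightarrow> bool" where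
  "quantifiers_scoped V (PAll \<sigma> \<Phi>) \<longleftrightarrow> quantifiers_scoped (insert \<sigma> V) \<Phi>"
| "quantifiers_scoped V (PAnd \<Phi> \<Psi>) \<longleftrightarrow> quantifiers_scoped V \<Phi> \<and> quantifiers_scoped V \<Psi>"
| "quantifiers_scoped V (PNot \<Phi>) \<longleftrightarrow> quantifiers_scoped V \<Phi>"
| "quantifiers_scoped V (PHyper \<xi>) \<longleftrightarrow> hctl_scheds \<xi> \<subseteq> V"
| "quantifiers_scoped V (PCmp P r c) \<longleftrightarrow> True"

definition well_formed :: "'p phl \<Rightarrow> bool" where
  "well_formed \<Phi> \<longleftrightarrow> quantifiers_scoped {} \<Phi>"


section \<open>Semantics of PHL\<close>

definition last_pos :: "('k \<times> 'v) list \<Rightarrow> 'k \<Rightarrow> nat" where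
  "last_pos xs k = Max {i. i < length xs \<and> fst (xs ! i) = k}"

definition assigned :: "('k \<times> 'v) list \<Rightarrow> 'k \<Rightarrow> 'v" where
  "assigned xs k = snd (xs ! last_pos xs k)"

type_synonym ('s, 'a) sched_assignment = "(svar \<times> ('s, 'a) sched) list"

text \<open>
  An infinite path of an MDP is represented by its state sequence; formulas cannot observe
  the actions on it.
\<close>

type_synonym 's path_assignment = "(pvar \<times> (nat \<Rightarrow> 's)) list"

definition shift_paths :: "nat \<Rightarrow> 's path_assignment \<Rightarrow> 's path_assignment" where
  "shift_paths j \<Theta> = map (\<lambda>(\<pi>, \<rho>). (\<pi>, \<lambda>i. \<rho> (i + j))) \<Theta>"

text \<open>
  If \<open>\<Theta>\<close> contains no path for \<open>\<sigma>\<close>, in particular if \<open>\<Theta>\<close> is empty, the paths start in the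
  initial states.  Otherwise the chain is restarted, with the one-state history, in the first
  state of the latest path for \<open>\<sigma>\<close>.
\<close>

definition quantified_chain ::
  "('s, 'a, 'l) mdp \<Rightarrow> ('s, 'a) sched_assignment \<Rightarrow> 's path_assignment \<Rightarrow> svar \<Rightarrow>
    (('s, 'a) hist, 'l) chain" where
  "quantified_chain M \<Sigma> \<Theta> \<sigma> =
    (let C = induced M (assigned \<Sigma> \<sigma>);
         \<Theta>' = map (\<lambda>(\<pi>, \<rho>). (psched \<pi>, \<rho>)) \<Theta>
     in if \<sigma> \<in> fst ` set \<Theta>' then C\<lparr>start := return_pmf ([], assigned \<Theta>' \<sigma> 0)\<rparr> else C)"

primrec hctl_sat ::
  "('s, 'a, 'p set) mdp \<Rightarrow> ('s, 'a) sched_assignment \<Rightarrow> 's path_assignment \<Rightarrow> 'p hctl \<Rightarrow> bool" where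
  "hctl_sat M \<Sigma> \<Theta> (HAtom a \<pi>) \<longleftrightarrow> a \<in> label M (assigned \<Theta> \<pi> 0)"
| "hctl_sat M \<Sigma> \<Theta> (HAnd \<xi> \<psi>) \<longleftrightarrow> hctl_sat M \<Sigma> \<Theta> \<xi> \<and> hctl_sat M \<Sigma> \<Theta> \<psi>"
| "hctl_sat M \<Sigma> \<Theta> (HNot \<xi>) \<longleftrightarrow> \<not> hctl_sat M \<Sigma> \<Theta> \<xi>"
| "hctl_sat M \<Sigma> \<Theta> (HNext \<xi>) \<longleftrightarrow> hctl_sat M \<Sigma> (shift_paths 1 \<Theta>) \<xi>"
| "hctl_sat M \<Sigma> \<Theta> (HUntil \<xi> \<psi>) \<longleftrightarrow>
    (\<exists>j. hctl_sat M \<Sigma> (shift_paths j \<Theta>) \<psi> \<and> (\<forall>i<j. hctl_sat M \<Sigma> (shift_paths i \<Theta>) \<xi>))"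
| "hctl_sat M \<Sigma> \<Theta> (HAll \<pi> \<xi>) \<longleftrightarrow>
    (\<forall>\<omega>\<in>chain_paths (quantified_chain M \<Sigma> \<Theta> (psched \<pi>)).
      hctl_sat M \<Sigma> (\<Theta> @ [(\<pi>, \<lambda>i. last_state (\<omega> i))]) \<xi>)"

text \<open>
  \<open>w\<close> is the trace of a path of the composed chain, and \<open>pos \<sigma>\<close> the component belonging to \<open>\<sigma>\<close>.
\<close>

primrec ltl_sat :: "(svar \<Rightarrow> nat) \<Rightarrow> (nat \<Rightarrow> 'p set list) \<Rightarrow> 'p ltl \<Rightarrow> bool" where
  "ltl_sat pos w (LAtom a \<sigma>) \<longleftrightarrow> a \<in> w 0 ! pos \<sigma>"
| "ltl_sat pos w (LAnd \<phi> \<psi>) \<longleftrightarrow> ltl_sat pos w \<phi> \<and> ltl_sat pos w \<psi>"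
| "ltl_sat pos w (LNot \<phi>) \<longleftrightarrow> \<not> ltl_sat pos w \<phi>"
| "ltl_sat pos w (LNext \<phi>) \<longleftrightarrow> ltl_sat pos (\<lambda>i. w (i + 1)) \<phi>"
| "ltl_sat pos w (LUntil \<phi> \<psi>) \<longleftrightarrow>
    (\<exists>j. ltl_sat pos (\<lambda>i. w (i + j)) \<psi> \<and> (\<forall>k<j. ltl_sat pos (\<lambda>i. w (i + k)) \<phi>))"

primrec pexp_val ::
  "(svar \<Rightarrow> nat) \<Rightarrow> ('h::countable, 'p set list) chain \<Rightarrow> 'p pexp \<Rightarrow> real" where
  "pexp_val pos C (Prob \<phi>) =
    measure (path_measure C) {\<omega>. ltl_sat pos (\<lambda>i. clabel C (\<omega> i)) \<phi>}"
| "pexp_val pos C (Plus P Q) = pexp_val pos C P + pexp_val pos C Q"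
| "pexp_val pos C (Scale c P) = of_rat c * pexp_val pos C P"

primrec cmp_rel :: "cmp \<Rightarrow> real \<Rightarrow> real \<Rightarrow> bool" where
  "cmp_rel Lt x y \<longleftrightarrow> x < y"
| "cmp_rel Le x y \<longleftrightarrow> x \<le> y"
| "cmp_rel Gt x y \<longleftrightarrow> x > y"
| "cmp_rel Ge x y \<longleftrightarrow> x \<ge> y"

definition assignment_chain ::
  "('s, 'a, 'l) mdp \<Rightarrow> ('s, 'a) sched_assignment \<Rightarrow> (('s list, 'a list) hist, 'l list) chain" where
  "assignment_chain M \<Sigma> = induced (self_comp (length \<Sigma>) M) (par_sched (map snd \<Sigma>))"

primrec phl_sat ::
  "('s::countable, 'a::countable, 'p set) mdp \<Rightarrow> ('s, 'a) sched_assignment \<Rightarrow> 'p phl \<Rightarrow> bool" where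
  "phl_sat M \<Sigma> (PAll \<sigma> \<Phi>) \<longleftrightarrow> (\<forall>\<SS>\<in>Sched M. phl_sat M (\<Sigma> @ [(\<sigma>, \<SS>)]) \<Phi>)"
| "phl_sat M \<Sigma> (PAnd \<Phi> \<Psi>) \<longleftrightarrow> phl_sat M \<Sigma> \<Phi> \<and> phl_sat M \<Sigma> \<Psi>"
| "phl_sat M \<Sigma> (PNot \<Phi>) \<longleftrightarrow> \<not> phl_sat M \<Sigma> \<Phi>"
| "phl_sat M \<Sigma> (PHyper \<xi>) \<longleftrightarrow> hctl_sat M \<Sigma> [] \<xi>"
| "phl_sat M \<Sigma> (PCmp P r c) \<longleftrightarrow>
    cmp_rel r (pexp_val (last_pos \<Sigma>) (assignment_chain M \<Sigma>) P) (of_rat c)"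

definition phl_models :: "('s::countable, 'a::countable, 'p set) mdp \<Rightarrow> 'p phl \<Rightarrow> bool" where
  "phl_models M \<Phi> \<longleftrightarrow> phl_sat M [] \<Phi>"


section \<open>Finite presentations and their encodings\<close>

text \<open>
  Finite rational MDPs as inputs of an algorithm: states, actions and atomic propositions are
  initial segments of the natural numbers, everything else is given by tables.
\<close>

record mdp_table =
  nstates :: nat
  nactions :: nat
  naps :: nat
  tprob_table :: "rat list list list"
  iprob_table :: "rat list"
  label_table :: "nat list list"

definition table_mdp :: "mdp_table \<Rightarrow> (nat, nat, nat set) mdp" where
  "table_mdp D =
    \<lparr>states = {..<nstates D},
     actions = {..<nactions D},
     tprob = (\<lambda>s a s'. if s < nstates D \<and> a < nactions D \<and> s' < nstates D
       then of_rat (tprob_table D ! s ! a ! s') else 0),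
     iprob = (\<lambda>s. if s < nstates D then of_rat (iprob_table D ! s) else 0),
     label = (\<lambda>s. set (label_table D ! s))\<rparr>"

definition valid_table :: "mdp_table \<Rightarrow> bool" where
  "valid_table D \<longleftrightarrow>
    length (tprob_table D) = nstates D \<and>
    (\<forall>row\<in>set (tprob_table D). length row = nactions D \<and>
      (\<forall>entry\<in>set row. length entry = nstates D)) \<and>
    length (iprob_table D) = nstates D \<and>
    length (label_table D) = nstates D \<and>
    is_mdp {..<naps D} (table_mdp D)"

definition rat_code :: "rat \<Rightarrow> nat" where
  "rat_code q = (case quotient_of q of (a, b) \<Rightarrow> prod_encode (int_encode a, int_encode b))"

definition table_code :: "mdp_table \<Rightarrow> nat" where
  "table_code D = list_encode
    [nstates D, nactions D, naps D,
     list_encode (map (\<lambda>row. list_encode (map (\<lambda>entry. list_encode (map rat_code entry)) row))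
       (tprob_table D)),
     list_encode (map rat_code (iprob_table D)),
     list_encode (map list_encode (label_table D))]"

primrec hctl_code :: "nat hctl \<Rightarrow> nat" where
  "hctl_code (HAtom a \<pi>) = list_encode [0, a, pname \<pi>, psched \<pi>]"
| "hctl_code (HAnd \<xi> \<psi>) = list_encode [1, hctl_code \<xi>, hctl_code \<psi>]"
| "hctl_code (HNot \<xi>) = list_encode [2, hctl_code \<xi>]"
| "hctl_code (HNext \<xi>) = list_encode [3, hctl_code \<xi>]"
| "hctl_code (HUntil \<xi> \<psi>) = list_encode [4, hctl_code \<xi>, hctl_code \<psi>]"
| "hctl_code (HAll \<pi> \<xi>) = list_encode [5, pname \<pi>, psched \<pi>, hctl_code \<xi>]"

primrec ltl_code :: "nat ltl \<Rightarrow> nat" where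
  "ltl_code (LAtom a \<sigma>) = list_encode [0, a, \<sigma>]"
| "ltl_code (LAnd \<phi> \<psi>) = list_encode [1, ltl_code \<phi>, ltl_code \<psi>]"
| "ltl_code (LNot \<phi>) = list_encode [2, ltl_code \<phi>]"
| "ltl_code (LNext \<phi>) = list_encode [3, ltl_code \<phi>]"
| "ltl_code (LUntil \<phi> \<psi>) = list_encode [4, ltl_code \<phi>, ltl_code \<psi>]"

primrec pexp_code :: "nat pexp \<Rightarrow> nat" where
  "pexp_code (Prob \<phi>) = list_encode [0, ltl_code \<phi>]"
| "pexp_code (Plus P Q) = list_encode [1, pexp_code P, pexp_code Q]"
| "pexp_code (Scale c P) = list_encode [2, rat_code c, pexp_code P]"

primrec cmp_code :: "cmp \<Rightarrow> nat" where
  "cmp_code Lt = 0"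
| "cmp_code Le = 1"
| "cmp_code Gt = 2"
| "cmp_code Ge = 3"

primrec phl_code :: "nat phl \<Rightarrow> nat" where
  "phl_code (PAll \<sigma> \<Phi>) = list_encode [0, \<sigma>, phl_code \<Phi>]"
| "phl_code (PAnd \<Phi> \<Psi>) = list_encode [1, phl_code \<Phi>, phl_code \<Psi>]"
| "phl_code (PNot \<Phi>) = list_encode [2, phl_code \<Phi>]"
| "phl_code (PHyper \<xi>) = list_encode [3, hctl_code \<xi>]"
| "phl_code (PCmp P r c) = list_encode [4, pexp_code P, cmp_code r, rat_code c]"

definition instance_code :: "mdp_table \<times> nat phl \<Rightarrow> nat" where
  "instance_code = (\<lambda>(D, \<Phi>). prod_encode (table_code D, phl_code \<Phi>))"

lemma list_encode_eq_iff [simp]: "list_encode xs = list_encode ys \<longleftrightarrow> xs = ys"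
  by (metis list_encode_inverse)

lemma inj_rat_code: "inj rat_code"
  by (rule injI) (auto simp: rat_code_def int_encode_eq split: prod.splits intro: quotient_of_inject)

lemma inj_table_code: "inj table_code"
proof (rule injI)
  fix D E assume eq: "table_code D = table_code E"
  have inj_list: "inj (list_encode \<circ> map f)" if "inj f" for f :: "'x \<Rightarrow> nat"
    using that by (auto intro!: injI dest: injD)
  note i1 = inj_list[OF inj_rat_code]
  note i2 = inj_list[OF i1]
  note i3 = inj_list[OF i2]
  have i4: "inj (list_encode \<circ> map list_encode)"
    by (rule inj_list) (auto intro!: injI)
  show "D = E"
    using eq injD[OF i1, of "iprob_table D" "iprob_table E"]
      injD[OF i3, of "tprob_table D" "tprob_table E"]
      injD[OF i4, of "label_table D" "label_table E"]
    by (cases D; cases E) (simp add: table_code_def comp_def)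
qed

lemma inj_hctl_code: "inj hctl_code"
proof (rule injI)
  show "hctl_code \<xi> = hctl_code \<psi> \<Longrightarrow> \<xi> = \<psi>" for \<xi> \<psi>
    by (induction \<xi> arbitrary: \<psi>; case_tac \<psi>) (auto intro: pvar.expand)
qed

lemma inj_ltl_code: "inj ltl_code"
proof (rule injI)
  show "ltl_code \<xi> = ltl_code \<psi> \<Longrightarrow> \<xi> = \<psi>" for \<xi> \<psi>
    by (induction \<xi> arbitrary: \<psi>; case_tac \<psi>) auto
qed

lemma inj_pexp_code: "inj pexp_code"
proof (rule injI)
  show "pexp_code \<xi> = pexp_code \<psi> \<Longrightarrow> \<xi> = \<psi>" for \<xi> \<psi>
    by (induction \<xi> arbitrary: \<psi>; case_tac \<psi>)
      (auto dest: injD[OF inj_ltl_code] injD[OF inj_rat_code])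
qed

lemma inj_cmp_code: "inj cmp_code"
  by (rule injI) (case_tac x; case_tac y; simp)

lemma inj_phl_code: "inj phl_code"
proof (rule injI)
  show "phl_code \<xi> = phl_code \<psi> \<Longrightarrow> \<xi> = \<psi>" for \<xi> \<psi>
    by (induction \<xi> arbitrary: \<psi>; case_tac \<psi>)
      (auto dest: injD[OF inj_hctl_code] injD[OF inj_pexp_code] injD[OF inj_cmp_code]
        injD[OF inj_rat_code])
qed

lemma inj_instance_code: "inj instance_code"
  by (rule injI) (auto simp: instance_code_def dest: injD[OF inj_table_code] injD[OF inj_phl_code])

definition phl_instances :: "(mdp_table \<times> nat phl) set" where
  "phl_instances =
    {(D, \<Phi>). valid_table D \<and> well_formed \<Phi> \<and> closed_phl \<Phi> \<and> phl_aps \<Phi> \<subseteq> {..<naps D}}"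

end

theory Submission
  imports Defs
begin

text \<open>
  In an MDP with deterministic transitions whose labels are all sets of four atoms, a path on which
  every atom occurs exactly once encodes a vector of four natural numbers by the positions of the
  atoms.  Since schedulers may randomise, the paths of a scheduler can encode any set of vectors:
  the quantifier over schedulers ranges over the 4-ary relations on the natural numbers.  HyperCTL*
  compares positions on several paths, up to constant offsets, and thus expresses that such a
  relation is closed under Horn rules.  The evaluation of a partial recursive function is described
  by finitely many Horn rules, so the function halts on \<open>n\<close> iff every closed relation contains
  the fact that it halts on \<open>n\<close>, and a decision procedure is refuted by diagonalisation.
\<close>

section \<open>Computable functions\<close>

definition computable :: "(nat \<Rightarrow> nat) \<Rightarrow> bool" where
  "computable F \<longleftrightarrow> (\<exists>r. \<forall>x. rec_eval r [x] (F x))"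

lemma rec_eval_Comp1: "rec_eval g xs y \<Longrightarrow> rec_eval f [y] z \<Longrightarrow> rec_eval (Comp f [g]) xs z"
  by (rule rec_eval.Comp[of "[y]"]) auto

lemma rec_eval_Comp2:
  assumes "rec_eval g xs y" "rec_eval h xs y'" "rec_eval f [y, y'] z"
  shows "rec_eval (Comp f [g, h]) xs z"
  by (rule rec_eval.Comp[of "[y, y']"]) (use assms in \<open>auto simp: less_Suc_eq\<close>)

lemma rec_eval_Proj: "i < length xs \<Longrightarrow> xs ! i = y \<Longrightarrow> rec_eval (Proj i) xs y"
  using rec_eval.Proj by blast

lemma rec_eval_const: "\<exists>r. \<forall>xs. rec_eval r xs c"
proof (induction c)
  case 0
  show ?case using rec_eval.Zero by blast
next
  case (Suc c)
  then show ?case using rec_eval_Comp1 rec_eval.Succ by blast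
qed

section \<open>Addition, triangular numbers and Cantor pairing\<close>

definition rec_add :: recf where
  "rec_add = PrimRec (Proj 0) (Comp Succ [Proj 1])"

lemma rec_add: "rec_eval rec_add [m, n] (m + n)"
proof (induction m)
  case 0
  show ?case unfolding rec_add_def by (auto intro!: rec_eval.PrimRec_0 rec_eval_Proj)
next
  case (Suc m)
  show ?case unfolding rec_add_def
    by (rule rec_eval.PrimRec_Suc[OF Suc[unfolded rec_add_def]])
      (auto intro!: rec_eval_Comp1[of _ _ "m + n"] rec_eval_Proj rec_eval.Succ)
qed

definition rec_triangle :: recf where
  "rec_triangle = PrimRec Zero (Comp rec_add [Proj 1, Comp Succ [Proj 0]])"

lemma rec_triangle: "rec_eval rec_triangle [n] (triangle n)"
proof (induction n)
  case 0
  show ?case unfolding rec_triangle_def by (auto intro!: rec_eval.PrimRec_0 rec_eval.Zero)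
next
  case (Suc n)
  have "rec_eval (Comp rec_add [Proj 1, Comp Succ [Proj 0]]) [n, triangle n] (triangle (Suc n))"
    unfolding triangle_Suc
    by (rule rec_eval_Comp2[OF _ _ rec_add])
      (auto intro!: rec_eval_Comp1[of _ _ n] rec_eval_Proj rec_eval.Succ)
  then show ?case unfolding rec_triangle_def
    by (rule rec_eval.PrimRec_Suc[OF Suc[unfolded rec_triangle_def]])
qed

lemma computable_id: "computable (\<lambda>x. x)"
  unfolding computable_def by (auto intro!: exI[of _ "Proj 0"] rec_eval_Proj)

lemma computable_const: "computable (\<lambda>x. c)"
  unfolding computable_def using rec_eval_const by blast

lemma computable_Suc: "computable F \<Longrightarrow> computable (\<lambda>x. Suc (F x))"
  unfolding computable_def using rec_eval_Comp1 rec_eval.Succ by blast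

text \<open>By definition \<open>prod_encode (m, n)\<close> is \<open>triangle (m + n) + m\<close>.
  Codes of lists are built from pairs and successors, so this also covers the codes of formulas
  assembled from computable parts.\<close>

lemma computable_prod_encode:
  assumes "computable F" "computable G"
  shows "computable (\<lambda>x. prod_encode (F x, G x))"
proof -
  from assms obtain r s where r: "\<And>x. rec_eval r [x] (F x)" and s: "\<And>x. rec_eval s [x] (G x)"
    unfolding computable_def by blast
  have "rec_eval (Comp rec_add [Comp rec_triangle [Comp rec_add [r, s]], r]) [x]
      (prod_encode (F x, G x))" for x
    unfolding prod_encode_def prod.case
    by (rule rec_eval_Comp2[OF rec_eval_Comp1[OF rec_eval_Comp2[OF r s rec_add] rec_triangle] r rec_add])
  then show ?thesis unfolding computable_def by blast
qed

text \<open>Primitive recursion whose step ignores the counter: \<open>Proj 1\<close> selects the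
  previous value. Iteration is needed for the codes of formulas with \<open>x\<close> nested next
  operators.\<close>

lemma computable_iterate:
  assumes "computable H"
  shows "computable (\<lambda>x. (H ^^ x) c)"
proof -
  from assms obtain r where r: "\<And>x. rec_eval r [x] (H x)"
    unfolding computable_def by blast
  obtain k where k: "\<And>xs. rec_eval k xs c"
    using rec_eval_const by blast
  have "rec_eval (PrimRec k (Comp r [Proj 1])) [x] ((H ^^ x) c)" for x
  proof (induction x)
    case 0
    show ?case by (auto intro!: rec_eval.PrimRec_0 k)
  next
    case (Suc x)
    show ?case
      by (rule rec_eval.PrimRec_Suc[OF Suc])
        (auto intro!: rec_eval_Comp1[of _ _ "(H ^^ x) c"] rec_eval_Proj r)
  qed
  then show ?thesis unfolding computable_def by blast
qed

lemmas computable_intros =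
  computable_id computable_const computable_Suc computable_prod_encode computable_iterate


section \<open>Horn rules for the evaluation of recursive functions\<close>

type_synonym vec = "nat \<times> nat \<times> nat \<times> nat"

fun coord :: "vec \<Rightarrow> nat \<Rightarrow> nat" where
  "coord (a, b, c, d) i = [a, b, c, d] ! i"

text \<open>
  The entry \<open>Ref p i c\<close> demands the value of coordinate \<open>i\<close> of the vector matched by the
  \<open>p\<close>-th premise, increased by \<open>c\<close>.
\<close>

datatype entry = Any | Cst nat | Ref nat nat nat

type_synonym row = "entry list"

primrec entry_ok :: "vec list \<Rightarrow> nat \<Rightarrow> entry \<Rightarrow> bool" where
  "entry_ok vs x Any \<longleftrightarrow> True"
| "entry_ok vs x (Cst c) \<longleftrightarrow> x = c"
| "entry_ok vs x (Ref p i c) \<longleftrightarrow> x = coord (vs ! p) i + c"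

text \<open>The head of the row constrains coordinate \<open>j\<close>. Coordinates beyond the end
  of a row stay unconstrained, so rows may be shorter than four.\<close>

primrec row_ok :: "vec list \<Rightarrow> vec \<Rightarrow> nat \<Rightarrow> row \<Rightarrow> bool" where
  "row_ok vs v j [] \<longleftrightarrow> True"
| "row_ok vs v j (e # r) \<longleftrightarrow> entry_ok vs (coord v j) e \<and> row_ok vs v (Suc j) r"

text \<open>The vectors matched by the premises are collected in \<open>vs\<close>, to which later
  references point. The conclusion is existential in the coordinates that its row leaves open, so a
  rule can demand that a list be represented without saying by which number.\<close>

primrec rule_ok :: "vec set \<Rightarrow> vec list \<Rightarrow> row list \<Rightarrow> row \<Rightarrow> bool" where
  "rule_ok R vs [] r \<longleftrightarrow> (\<exists>v\<in>R. row_ok vs v 0 r)"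
| "rule_ok R vs (p # ps) r \<longleftrightarrow> (\<forall>v\<in>R. row_ok vs v 0 p \<longrightarrow> rule_ok R (vs @ [v]) ps r)"

definition closed_under :: "vec set \<Rightarrow> (row list \<times> row) list \<Rightarrow> bool" where
  "closed_under R rs \<longleftrightarrow> (\<forall>(ps, r)\<in>set rs. rule_ok R [] ps r)"

lemma closed_under_simps [simp]:
  "closed_under R []"
  "closed_under R ((ps, r) # rs) \<longleftrightarrow> rule_ok R [] ps r \<and> closed_under R rs"
  "closed_under R (rs @ rs') \<longleftrightarrow> closed_under R rs \<and> closed_under R rs'"
  "closed_under R (concat rss) \<longleftrightarrow> (\<forall>rs\<in>set rss. closed_under R rs)"
  by (auto simp: closed_under_def)

instance recf :: countable
  by countable_datatype

text \<open>
  The facts are vectors \<open>(t, a, b, c)\<close> headed by the number of a tag.  Lists are represented by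
  numbers, the empty one by \<open>0\<close>: \<open>TCons\<close> states that \<open>c\<close> represents the list with head
  \<open>a\<close> and tail \<open>b\<close>, \<open>TEval f\<close> that \<open>f\<close> maps the list \<open>a\<close> to \<open>b\<close>, \<open>TList gs\<close> that
  \<open>gs\<close> map the list \<open>a\<close> to the members of the list \<open>b\<close>, \<open>TMu f\<close> that \<open>f\<close> is positive on
  \<open>i # b\<close> for all \<open>i < a\<close>, and \<open>THalt\<close> that the program halts on \<open>a\<close>.
\<close>

datatype tag = TCons | THalt | TEval recf | TList "recf list" | TMu recf

instance tag :: countable
  by countable_datatype

abbreviation Tag :: "tag \<Rightarrow> entry" where
  "Tag t \<equiv> Cst (to_nat t)"

text \<open>No coding of lists is fixed. The rules demand a cell with head \<open>0\<close> on the
  empty list and on every list given by a cell; since offsets are constant, the other heads are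
  reached by counting up.\<close>

definition cons_rules :: "(row list \<times> row) list" where
  "cons_rules =
    [([], [Tag TCons, Cst 0, Cst 0]),
     ([[Tag TCons]], [Tag TCons, Ref 0 1 1, Ref 0 2 0]),
     ([[Tag TCons]], [Tag TCons, Cst 0, Ref 0 3 0])]"

primrec proj_rules :: "nat \<Rightarrow> (row list \<times> row) list" where
  "proj_rules 0 = [([[Tag TCons]], [Tag (TEval (Proj 0)), Ref 0 3 0, Ref 0 1 0])]"
| "proj_rules (Suc i) =
    ([[Tag TCons], [Tag (TEval (Proj i)), Ref 0 2 0]],
      [Tag (TEval (Proj (Suc i))), Ref 0 3 0, Ref 1 2 0]) # proj_rules i"

text \<open>A conclusion about all lists needs a premise that ranges over them. It is therefore
  stated twice, for the empty list \<open>0\<close> and for the third coordinate of a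
  \<open>TCons\<close> fact; \<open>rules\<close> does the same for \<open>Zero\<close> and
  \<open>Mu\<close>.\<close>

primrec list_rules :: "recf list \<Rightarrow> (row list \<times> row) list" where
  "list_rules [] =
    [([], [Tag (TList []), Cst 0, Cst 0]),
     ([[Tag TCons]], [Tag (TList []), Ref 0 3 0, Cst 0])]"
| "list_rules (g # gs) =
    ([[Tag (TEval g)], [Tag (TList gs), Ref 0 1 0], [Tag TCons, Ref 0 2 0, Ref 1 2 0]],
      [Tag (TList (g # gs)), Ref 0 1 0, Ref 2 3 0]) # list_rules gs"

text \<open>The six premises for \<open>PrimRec\<close> supply, in order, the list
  \<open>n # xs\<close>, the recursive result \<open>r\<close>, the lists \<open>r # xs\<close> and
  \<open>n # r # xs\<close>, the value of \<open>g\<close>, and the list \<open>Suc n # xs\<close>.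
  In the third rule for \<open>Mu\<close>, the bare premise \<open>[Tag TCons]\<close> ranges over a
  number whose successor \<open>Ref 2 1 1\<close> is the value of \<open>f\<close>; this expresses
  positivity.\<close>

primrec rules :: "recf \<Rightarrow> (row list \<times> row) list" where
  "rules Zero =
    [([], [Tag (TEval Zero), Cst 0, Cst 0]),
     ([[Tag TCons]], [Tag (TEval Zero), Ref 0 3 0, Cst 0])]"
| "rules Succ = [([[Tag TCons, Any, Cst 0]], [Tag (TEval Succ), Ref 0 3 0, Ref 0 1 1])]"
| "rules (Proj i) = proj_rules i"
| "rules (Comp f gs) =
    ([[Tag (TList gs)], [Tag (TEval f), Ref 0 2 0]],
      [Tag (TEval (Comp f gs)), Ref 0 1 0, Ref 1 2 0]) #
    list_rules gs @ rules f @ concat (map rules gs)"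
| "rules (PrimRec f g) =
    ([[Tag (TEval f)], [Tag TCons, Cst 0, Ref 0 1 0]],
      [Tag (TEval (PrimRec f g)), Ref 1 3 0, Ref 0 2 0]) #
    ([[Tag TCons],
      [Tag (TEval (PrimRec f g)), Ref 0 3 0],
      [Tag TCons, Ref 1 2 0, Ref 0 2 0],
      [Tag TCons, Ref 0 1 0, Ref 2 3 0],
      [Tag (TEval g), Ref 3 3 0],
      [Tag TCons, Ref 0 1 1, Ref 0 2 0]],
      [Tag (TEval (PrimRec f g)), Ref 5 3 0, Ref 4 2 0]) #
    rules f @ rules g"
| "rules (Mu f) =
    ([], [Tag (TMu f), Cst 0, Cst 0]) #
    ([[Tag TCons]], [Tag (TMu f), Cst 0, Ref 0 3 0]) #
    ([[Tag (TMu f)], [Tag TCons, Ref 0 1 0, Ref 0 2 0], [Tag TCons],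
      [Tag (TEval f), Ref 1 3 0, Ref 2 1 1]],
      [Tag (TMu f), Ref 0 1 1, Ref 0 2 0]) #
    ([[Tag (TMu f)], [Tag TCons, Ref 0 1 0, Ref 0 2 0], [Tag (TEval f), Ref 1 3 0, Cst 0]],
      [Tag (TEval (Mu f)), Ref 0 2 0, Ref 0 1 0]) #
    rules f"

definition program_rules :: "recf \<Rightarrow> (row list \<times> row) list" where
  "program_rules f =
    ([[Tag TCons, Any, Cst 0], [Tag (TEval f), Ref 0 3 0]], [Tag THalt, Ref 0 1 0]) #
    cons_rules @ rules f"

section \<open>True facts hold in every closed relation\<close>

text \<open>In an arbitrary relation \<open>TCons\<close> need be neither functional nor injective:
  a list may have several numbers, and a number may represent several lists.\<close>

primrec represents :: "vec set \<Rightarrow> nat \<Rightarrow> nat list \<Rightarrow> bool" where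
  "represents R l [] \<longleftrightarrow> l = 0"
| "represents R l (x # xs) \<longleftrightarrow> (\<exists>m. represents R m xs \<and> (to_nat TCons, x, m, l) \<in> R)"

lemma split_vec: "(\<exists>v\<in>R. P v) \<longleftrightarrow> (\<exists>a b c d. (a, b, c, d) \<in> R \<and> P (a, b, c, d))"
  "(\<forall>v\<in>R. P v) \<longleftrightarrow> (\<forall>a b c d. (a, b, c, d) \<in> R \<longrightarrow> P (a, b, c, d))"
  for R :: "vec set"
  by auto

text \<open>An explicit choice \<open>ws\<close> of vectors for the premises, used to apply the long
  rules without a search for instances.\<close>

fun matches :: "vec set \<Rightarrow> vec list \<Rightarrow> vec list \<Rightarrow> row list \<Rightarrow> bool" where
  "matches R vs [] [] \<longleftrightarrow> True"
| "matches R vs (w # ws) (p # ps) \<longleftrightarrow> w \<in> R \<and> row_ok vs w 0 p \<and> matches R (vs @ [w]) ws ps"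
| "matches R vs _ _ \<longleftrightarrow> False"

lemma rule_ok_matches:
  "matches R vs ws ps \<Longrightarrow> rule_ok R vs ps r \<Longrightarrow> \<exists>v\<in>R. row_ok (vs @ ws) v 0 r"
  by (induction R vs ws ps rule: matches.induct) auto

text \<open>Induction on the head: the first or third rule gives head \<open>0\<close>, depending on
  whether \<open>xs\<close> is empty, and the second rule increments it.\<close>

lemma represents_Cons_exists:
  assumes "closed_under R cons_rules" "represents R m xs"
  shows "\<exists>l. (to_nat TCons, x, m, l) \<in> R"
proof (induction x)
  case 0
  show ?case
    using assms by (cases xs) (auto simp: cons_rules_def split_vec)
next
  case (Suc x)
  then show ?case
    using assms(1) by (auto simp: cons_rules_def split_vec)
qed

lemma proj_rules_sound:
  assumes "closed_under R (proj_rules i)" "i < length xs" "represents R l xs"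
  shows "\<exists>d. (to_nat (TEval (Proj i)), l, xs ! i, d) \<in> R"
  using assms
proof (induction i arbitrary: xs l)
  case 0
  then show ?case by (cases xs) (auto simp: split_vec)
next
  case (Suc i)
  then obtain x ys m where xs: "xs = x # ys" "represents R m ys" "(to_nat TCons, x, m, l) \<in> R"
    by (cases xs) auto
  with Suc obtain d where "(to_nat (TEval (Proj i)), m, ys ! i, d) \<in> R"
    by fastforce
  with xs Suc.prems(1) show ?case by (simp add: split_vec) blast
qed

lemma list_rules_sound:
  assumes "closed_under R cons_rules" "closed_under R (list_rules gs)" "represents R l xs"
    "length ys = length gs"
    "\<And>i. i < length gs \<Longrightarrow> \<exists>d. (to_nat (TEval (gs ! i)), l, ys ! i, d) \<in> R"
  shows "\<exists>m d. represents R m ys \<and> (to_nat (TList gs), l, m, d) \<in> R"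
  using assms(2,4,5)
proof (induction gs arbitrary: ys)
  case Nil
  then show ?case
    using assms(3) by (cases xs) (auto simp: split_vec)
next
  case (Cons g gs)
  then obtain y zs where ys: "ys = y # zs" by (cases ys) auto
  have "\<exists>m d. represents R m zs \<and> (to_nat (TList gs), l, m, d) \<in> R"
    using Cons.prems ys by (intro Cons.IH) force+
  then obtain m d where m: "represents R m zs" "(to_nat (TList gs), l, m, d) \<in> R" by blast
  obtain k where k: "(to_nat TCons, y, m, k) \<in> R"
    using represents_Cons_exists[OF assms(1) m(1)] by blast
  obtain d' where "(to_nat (TEval g), l, y, d') \<in> R"
    using Cons.prems(3)[of 0] ys by auto
  then have "\<exists>d. (to_nat (TList (g # gs)), l, k, d) \<in> R"
    using Cons.prems(1) m(2) k by (simp add: split_vec) blast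
  then show ?case
    using m(1) k ys by auto
qed

text \<open>Induction on the evaluation. Every auxiliary list it mentions has a number by
  \<open>represents_Cons_exists\<close>, and the rule for the constructor then applies. The claim
  covers every number \<open>l\<close> of the argument list, as the induction needs.\<close>

lemma rules_sound:
  assumes "rec_eval f xs y" "closed_under R cons_rules" "closed_under R (rules f)"
    "represents R l xs"
  shows "\<exists>d. (to_nat (TEval f), l, y, d) \<in> R"
  using assms(1,3,4)
proof (induction arbitrary: l rule: rec_eval.induct)
  case (Zero xs)
  then show ?case by (cases xs) (auto simp: split_vec)
next
  case (Succ x)
  then show ?case by (auto simp: split_vec)
next
  case (Proj i xs)
  then show ?case by (intro proj_rules_sound) auto
next
  case (Comp ys gs xs f z)
  have "\<exists>m d. represents R m ys \<and> (to_nat (TList gs), l, m, d) \<in> R"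
    using Comp by (intro list_rules_sound[OF assms(2)]) auto
  then obtain m d where m: "represents R m ys" "(to_nat (TList gs), l, m, d) \<in> R" by blast
  obtain d' where "(to_nat (TEval f), m, z, d') \<in> R"
    using Comp.IH(2)[OF _ m(1)] Comp.prems by auto
  with m(2) Comp.prems(1) show ?case by (simp add: split_vec) blast
next
  case (PrimRec_0 f xs y g)
  from PrimRec_0.prems obtain m where m: "represents R m xs" "(to_nat TCons, 0, m, l) \<in> R" by auto
  obtain d where "(to_nat (TEval f), m, y, d) \<in> R"
    using PrimRec_0.IH[OF _ m(1)] PrimRec_0.prems by auto
  with m(2) PrimRec_0.prems(1) show ?case by (simp add: split_vec) blast
next
  case (PrimRec_Suc f g n xs r y)
  from PrimRec_Suc.prems obtain m where m: "represents R m xs" "(to_nat TCons, Suc n, m, l) \<in> R"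
    by auto
  obtain l1 where l1: "(to_nat TCons, n, m, l1) \<in> R"
    using represents_Cons_exists[OF assms(2) m(1)] by blast
  obtain l2 where l2: "(to_nat TCons, r, m, l2) \<in> R"
    using represents_Cons_exists[OF assms(2) m(1)] by blast
  have r2: "represents R l2 (r # xs)"
    using l2 m(1) by auto
  obtain l3 where l3: "(to_nat TCons, n, l2, l3) \<in> R"
    using represents_Cons_exists[OF assms(2) r2] by blast
  obtain d where d: "(to_nat (TEval (PrimRec f g)), l1, r, d) \<in> R"
    using PrimRec_Suc.IH(1)[OF PrimRec_Suc.prems(1)] l1 m(1) by fastforce
  have "represents R l3 (n # r # xs)"
    using l3 r2 by auto
  then obtain d' where d': "(to_nat (TEval g), l3, y, d') \<in> R"
    using PrimRec_Suc.IH(2) PrimRec_Suc.prems(1) by fastforce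
  have "rule_ok R []
    [[Tag TCons],
      [Tag (TEval (PrimRec f g)), Ref 0 3 0],
      [Tag TCons, Ref 1 2 0, Ref 0 2 0],
      [Tag TCons, Ref 0 1 0, Ref 2 3 0],
      [Tag (TEval g), Ref 3 3 0],
      [Tag TCons, Ref 0 1 1, Ref 0 2 0]]
      [Tag (TEval (PrimRec f g)), Ref 5 3 0, Ref 4 2 0]"
    using PrimRec_Suc.prems(1) by simp
  \<comment> \<open>Matching the last premise with the given cell for \<open>Suc n # xs\<close>
    makes the conclusion speak of \<open>l\<close> itself and not of another number of the same
    list.\<close>
  from rule_ok_matches[OF _ this, of "[(to_nat TCons, n, m, l1),
      (to_nat (TEval (PrimRec f g)), l1, r, d), (to_nat TCons, r, m, l2),
      (to_nat TCons, n, l2, l3), (to_nat (TEval g), l3, y, d'), (to_nat TCons, Suc n, m, l)]"]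
  show ?case
    using l1 d l2 l3 d' m(2) by (simp add: split_vec)
next
  case (Mu f n xs)
  \<comment> \<open>The bounded universal statement is accumulated by counting \<open>i\<close> up
    to \<open>n\<close>.\<close>
  have tm: "\<exists>d. (to_nat (TMu f), i, l, d) \<in> R" if "i \<le> n" for i
    using that
  proof (induction i)
    case 0
    show ?case
      using Mu.prems by (cases xs) (auto simp: split_vec)
  next
    case (Suc i)
    then obtain d where d: "(to_nat (TMu f), i, l, d) \<in> R" by auto
    obtain l1 where l1: "(to_nat TCons, i, l, l1) \<in> R"
      using represents_Cons_exists[OF assms(2) Mu.prems(2)] by blast
    have "represents R l1 (i # xs)"
      using l1 Mu.prems(2) by auto
    then obtain y d' where y: "(to_nat (TEval f), l1, Suc y, d') \<in> R"
      using Mu.IH(2)[of i] Suc.prems Mu.prems(1) by fastforce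
    \<comment> \<open>This cell instantiates the premise that names the predecessor \<open>y\<close>
      of the positive value.\<close>
    obtain l2 where l2: "(to_nat TCons, y, l, l2) \<in> R"
      using represents_Cons_exists[OF assms(2) Mu.prems(2)] by blast
    have "rule_ok R []
        [[Tag (TMu f)], [Tag TCons, Ref 0 1 0, Ref 0 2 0], [Tag TCons],
          [Tag (TEval f), Ref 1 3 0, Ref 2 1 1]]
        [Tag (TMu f), Ref 0 1 1, Ref 0 2 0]"
      using Mu.prems(1) by simp
    from rule_ok_matches[OF _ this, of "[(to_nat (TMu f), i, l, d), (to_nat TCons, i, l, l1),
        (to_nat TCons, y, l, l2), (to_nat (TEval f), l1, Suc y, d')]"]
    show ?case
      using d l1 l2 y by (simp add: split_vec)
  qed
  obtain l1 where l1: "(to_nat TCons, n, l, l1) \<in> R"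
    using represents_Cons_exists[OF assms(2) Mu.prems(2)] by blast
  then have "represents R l1 (n # xs)"
    using Mu.prems(2) by auto
  then obtain d where d: "(to_nat (TEval f), l1, 0, d) \<in> R"
    using Mu.IH(1) Mu.prems(1) by fastforce
  obtain d' where d': "(to_nat (TMu f), n, l, d') \<in> R"
    using tm by blast
  have "rule_ok R []
      [[Tag (TMu f)], [Tag TCons, Ref 0 1 0, Ref 0 2 0], [Tag (TEval f), Ref 1 3 0, Cst 0]]
      [Tag (TEval (Mu f)), Ref 0 2 0, Ref 0 1 0]"
    using Mu.prems(1) by simp
  from rule_ok_matches[OF _ this, of "[(to_nat (TMu f), n, l, d'), (to_nat TCons, n, l, l1),
      (to_nat (TEval f), l1, 0, d)]"]
  show ?case
    using d d' l1 by (simp add: split_vec)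
qed

lemma program_rules_sound:
  assumes "rec_eval f [x] y" "closed_under R (program_rules f)"
  shows "\<exists>b c. (to_nat THalt, x, b, c) \<in> R"
proof -
  have c: "closed_under R cons_rules" "closed_under R (rules f)"
    using assms(2) by (simp_all add: program_rules_def)
  obtain l where l: "(to_nat TCons, x, 0, l) \<in> R"
    using represents_Cons_exists[OF c(1), of 0 "[]"] by auto
  moreover have "represents R l [x]"
    using l by simp
  ultimately show ?thesis
    using rules_sound[OF assms(1) c] assms(2)
    by (simp add: program_rules_def split_vec) blast
qed

section \<open>The intended interpretation as a closed relation\<close>

definition standard_model :: "recf \<Rightarrow> vec set" where
  "standard_model f = {(t, a, b, c). case from_nat t of
      TCons \<Rightarrow> list_decode c = a # list_decode b
    | THalt \<Rightarrow> \<exists>y. rec_eval f [a] y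
    | TEval g \<Rightarrow> rec_eval g (list_decode a) b
    | TList gs \<Rightarrow> list_all2 (\<lambda>g. rec_eval g (list_decode a)) gs (list_decode b)
    | TMu g \<Rightarrow> \<forall>i<a. \<exists>y. rec_eval g (i # list_decode b) (Suc y)}"

lemma standard_model_simps [simp]:
  "(to_nat TCons, a, b, c) \<in> standard_model f \<longleftrightarrow> list_decode c = a # list_decode b"
  "(to_nat THalt, a, b, c) \<in> standard_model f \<longleftrightarrow> (\<exists>y. rec_eval f [a] y)"
  "(to_nat (TEval g), a, b, c) \<in> standard_model f \<longleftrightarrow> rec_eval g (list_decode a) b"
  "(to_nat (TList gs), a, b, c) \<in> standard_model f \<longleftrightarrow>
    list_all2 (\<lambda>g. rec_eval g (list_decode a)) gs (list_decode b)"
  "(to_nat (TMu g), a, b, c) \<in> standard_model f \<longleftrightarrow>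
    (\<forall>i<a. \<exists>y. rec_eval g (i # list_decode b) (Suc y))"
  by (simp_all add: standard_model_def)

lemma list_decode_Cons_exists: "\<exists>l. list_decode l = x # xs"
  by (metis list_encode_inverse)

lemma standard_model_list_rules: "closed_under (standard_model f) (list_rules gs)"
  by (induction gs) (auto simp: split_vec)

lemma standard_model_proj_rules: "closed_under (standard_model f) (proj_rules i)"
  by (induction i)
    (auto simp: split_vec intro!: rec_eval_Proj elim!: rec_eval_elims(3))

lemma standard_model_rules: "closed_under (standard_model f) (rules g)"
proof (induction g)
  case Zero
  show ?case by (auto simp: split_vec intro: rec_eval.intros)
next
  case Succ
  show ?case by (auto simp: split_vec intro: rec_eval.intros)
next
  case (Proj i)
  show ?case by (simp add: standard_model_proj_rules)
next
  case (Comp g gs)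
  then show ?case
    by (auto simp: split_vec standard_model_list_rules list_all2_conv_all_nth intro: rec_eval.Comp)
next
  case (PrimRec g h)
  then show ?case
    by (auto simp: split_vec intro: rec_eval.PrimRec_0 rec_eval.PrimRec_Suc)
next
  case (Mu g)
  then show ?case
    by (auto simp: split_vec less_Suc_eq intro: rec_eval.Mu)
qed

text \<open>This gives a closed relation whose halting facts are exactly the true ones, so a program
  that diverges on an input is refuted by it.\<close>

lemma standard_model_program_rules: "closed_under (standard_model f) (program_rules f)"
  by (auto simp: program_rules_def cons_rules_def split_vec standard_model_rules
      list_decode_Cons_exists)


section \<open>Schedulers as sets of vectors\<close>

text \<open>The states are the numbers of the subsets of \<open>{0, 1, 2, 3}\<close>, and every action is the next state.\<close>

definition subset_table :: mdp_table where
  "subset_table =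
    \<lparr>nstates = 16, nactions = 16, naps = 4,
     tprob_table = replicate 16 (map (\<lambda>a. map (\<lambda>s. if s = a then 1 else 0) [0..<16]) [0..<16]),
     iprob_table = map (\<lambda>s. if s = 0 then 1 else 0) [0..<16],
     label_table = map (\<lambda>s. sorted_list_of_set (set_decode s)) [0..<16]\<rparr>"

abbreviation subset_mdp :: "(nat, nat, nat set) mdp" where
  "subset_mdp \<equiv> table_mdp subset_table"

lemma subset_mdp_simps [simp]:
  "states subset_mdp = {..<16}"
  "actions subset_mdp = {..<16}"
  "tprob subset_mdp s a s' = (if s < 16 \<and> a < 16 \<and> s' = a then 1 else 0)"
  "iprob subset_mdp s = (if s = 0 then 1 else 0)"
  "s < 16 \<Longrightarrow> label subset_mdp s = set_decode s"
  by (auto simp: table_mdp_def subset_table_def)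

lemma set_decode_subset:
  assumes "s < 16"
  shows "set_decode s \<subseteq> {..<4}"
proof
  fix i assume "i \<in> set_decode s"
  then have "s div 2 ^ i \<noteq> 0"
    by (intro notI) (simp add: set_decode_def)
  then have "(2::nat) ^ i \<le> s" by (auto simp: div_eq_0_iff)
  also have "\<dots> < 2 ^ 4" using assms by simp
  finally have "i < 4" by (rule power_less_imp_less_exp[rotated]) simp
  then show "i \<in> {..<4}" by simp
qed

lemma set_encode_less:
  assumes "A \<subseteq> {..<4}"
  shows "set_encode A < 16"
proof -
  have "set_encode A \<le> set_encode {..<4}"
    unfolding set_encode_def using assms by (intro sum_mono2) auto
  also have "\<dots> < 16"
    by (simp add: set_encode_def lessThan_nat_numeral lessThan_Suc)
  finally show ?thesis .
qed

lemma enabled_subset_mdp: "s < 16 \<Longrightarrow> enabled subset_mdp s = {..<16}"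
  by (auto simp: enabled_def)

lemma valid_subset_table: "valid_table subset_table"
proof -
  have "is_mdp {..<naps subset_table} subset_mdp"
    using set_decode_subset by (auto simp: is_mdp_def subset_table_def[THEN arg_cong, of naps])
  then show ?thesis
    by (auto simp: valid_table_def) (auto simp: subset_table_def)
qed

section \<open>State sequences generated by a scheduler\<close>

lemma embed_pmf_iprob: "embed_pmf (iprob subset_mdp) = return_pmf 0"
proof (rule pmf_eqI)
  show "pmf (embed_pmf (iprob subset_mdp)) s = pmf (return_pmf 0) s" for s
    by (subst pmf_embed_pmf_finite[of "{..<16}"]) (auto split: if_splits simp: indicator_def)
qed

lemma embed_pmf_tprob:
  assumes "s < 16" "a < 16"
  shows "embed_pmf (tprob subset_mdp s a) = return_pmf a"
proof (rule pmf_eqI)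
  show "pmf (embed_pmf (tprob subset_mdp s a)) s' = pmf (return_pmf a) s'" for s'
    using assms
    by (subst pmf_embed_pmf_finite[of "{..<16}"]) (auto split: if_splits simp: indicator_def)
qed

text \<open>Each action is the next state, so the state sequence determines the whole
  history.\<close>

definition path_hist :: "(nat \<Rightarrow> nat) \<Rightarrow> nat \<Rightarrow> (nat, nat) hist" where
  "path_hist \<tau> i = (map (\<lambda>j. (\<tau> j, \<tau> (Suc j))) [0..<i], \<tau> i)"

lemma path_hist_simps [simp]:
  "path_hist \<tau> 0 = ([], \<tau> 0)"
  "path_hist \<tau> (Suc i) = extend_hist (path_hist \<tau> i) (\<tau> (Suc i)) (\<tau> (Suc i))"
  "last_state (path_hist \<tau> i) = \<tau> i"
  by (simp_all add: path_hist_def extend_hist_def)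

definition traces :: "(nat, nat) sched \<Rightarrow> (nat \<Rightarrow> nat) set" where
  "traces \<SS> = {\<tau>. \<tau> 0 = 0 \<and> (\<forall>i. \<tau> (Suc i) \<in> set_pmf (\<SS> (path_hist \<tau> i)))}"

lemma Sched_subset_mdp:
  assumes "\<SS> \<in> Sched subset_mdp" "h \<in> histories subset_mdp"
  shows "set_pmf (\<SS> h) \<subseteq> {..<16}"
proof -
  have "last_state h < 16"
    using assms(2) by (auto simp: histories_def)
  then show ?thesis
    using assms enabled_subset_mdp by (auto simp: Sched_def)
qed

lemma set_pmf_step:
  assumes "\<SS> \<in> Sched subset_mdp" "h \<in> histories subset_mdp"
  shows "set_pmf (step (induced subset_mdp \<SS>) h) = (\<lambda>a. extend_hist h a a) ` set_pmf (\<SS> h)"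
proof -
  have "last_state h < 16"
    using assms(2) by (auto simp: histories_def)
  with Sched_subset_mdp[OF assms] show ?thesis
    by (auto simp: induced_def embed_pmf_tprob subset_iff)
qed

lemma histories_extend:
  assumes "h \<in> histories subset_mdp" "a < 16" "s < 16"
  shows "extend_hist h a s \<in> histories subset_mdp"
  using assms by (auto simp: histories_def extend_hist_def)

lemma path_hist_histories:
  assumes "\<SS> \<in> Sched subset_mdp" "\<tau> \<in> traces \<SS>"
  shows "path_hist \<tau> i \<in> histories subset_mdp"
proof (induction i)
  case 0
  show ?case using assms(2) by (auto simp: traces_def histories_def)
next
  case (Suc i)
  have "\<tau> (Suc i) < 16"
    using Sched_subset_mdp[OF assms(1) Suc] assms(2) by (auto simp: traces_def)
  with Suc show ?case by (simp add: histories_extend)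
qed

lemma chain_paths_hist:
  assumes "\<SS> \<in> Sched subset_mdp" "\<omega> \<in> chain_paths (induced subset_mdp \<SS>)"
  defines "\<tau> \<equiv> \<lambda>i. last_state (\<omega> i)"
  shows "\<omega> i = path_hist \<tau> i \<and> \<omega> i \<in> histories subset_mdp"
proof (induction i)
  case 0
  show ?case
    using assms(2) unfolding \<tau>_def
    by (auto simp: chain_paths_def induced_def embed_pmf_iprob histories_def)
next
  case (Suc i)
  then have h: "\<omega> i \<in> histories subset_mdp" ..
  have "\<omega> (Suc i) \<in> set_pmf (step (induced subset_mdp \<SS>) (\<omega> i))"
    using assms(2) by (simp add: chain_paths_def)
  then obtain a where a: "a \<in> set_pmf (\<SS> (\<omega> i))" "\<omega> (Suc i) = extend_hist (\<omega> i) a a"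
    using set_pmf_step[OF assms(1) h] by auto
  have "\<tau> (Suc i) = a" unfolding \<tau>_def a(2) by (simp add: extend_hist_def)
  moreover have "a < 16" using a(1) Sched_subset_mdp[OF assms(1) h] by auto
  ultimately show ?case
    using Suc a(2) histories_extend[OF h] by (metis path_hist_simps(2))
qed

lemma traces_eq:
  assumes "\<SS> \<in> Sched subset_mdp"
  shows "(\<lambda>\<omega> i. last_state (\<omega> i)) ` chain_paths (induced subset_mdp \<SS>) = traces \<SS>"
proof (intro equalityI subsetI)
  fix \<tau> assume "\<tau> \<in> (\<lambda>\<omega> i. last_state (\<omega> i)) ` chain_paths (induced subset_mdp \<SS>)"
  then obtain \<omega> where \<omega>: "\<omega> \<in> chain_paths (induced subset_mdp \<SS>)"
    and \<tau>: "\<tau> = (\<lambda>i. last_state (\<omega> i))" by blast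
  have h: "\<omega> i = path_hist \<tau> i" "\<omega> i \<in> histories subset_mdp" for i
    using chain_paths_hist[OF assms \<omega>] unfolding \<tau> by blast+
  have "\<tau> (Suc i) \<in> set_pmf (\<SS> (path_hist \<tau> i))" for i
  proof -
    have "\<omega> (Suc i) \<in> set_pmf (step (induced subset_mdp \<SS>) (\<omega> i))"
      using \<omega> by (simp add: chain_paths_def)
    then obtain a where "a \<in> set_pmf (\<SS> (\<omega> i))" "\<omega> (Suc i) = extend_hist (\<omega> i) a a"
      using set_pmf_step[OF assms h(2)] by auto
    then show ?thesis
      unfolding h(1)[symmetric] by (simp add: \<tau> extend_hist_def)
  qed
  moreover have "\<tau> 0 = 0"
    using \<omega> by (auto simp: \<tau> chain_paths_def induced_def embed_pmf_iprob)
  ultimately show "\<tau> \<in> traces \<SS>" by (simp add: traces_def)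
next
  fix \<tau> assume \<tau>: "\<tau> \<in> traces \<SS>"
  have "path_hist \<tau> \<in> chain_paths (induced subset_mdp \<SS>)"
    using \<tau> set_pmf_step[OF assms path_hist_histories[OF assms \<tau>]]
    by (auto simp: chain_paths_def traces_def) (simp add: induced_def embed_pmf_iprob)
  then show "\<tau> \<in> (\<lambda>\<omega> i. last_state (\<omega> i)) ` chain_paths (induced subset_mdp \<SS>)"
    by (rule rev_image_eqI) simp
qed

text \<open>
  A trace encodes the vector whose \<open>i\<close>-th coordinate is the number of steps from position \<open>1\<close>
  to the only occurrence of the atom \<open>i\<close>.
\<close>

definition encodes :: "(nat \<Rightarrow> nat) \<Rightarrow> vec \<Rightarrow> bool" where
  "encodes \<tau> v \<longleftrightarrow> (\<forall>i<4. \<forall>n. i \<in> label subset_mdp (\<tau> n) \<longleftrightarrow> n = Suc (coord v i))"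

definition encoded_vecs :: "(nat, nat) sched \<Rightarrow> vec set" where
  "encoded_vecs \<SS> = {v. \<exists>\<tau>\<in>traces \<SS>. encodes \<tau> v}"

lemma vec_eqI:
  assumes "\<And>i. i < 4 \<Longrightarrow> coord v i = coord w i"
  shows "v = w"
  using assms[of 0] assms[of 1] assms[of 2] assms[of 3] by (cases v; cases w) simp

lemma coord_exists: "\<exists>v. \<forall>i<4. coord v i = f i"
  by (rule exI[of _ "(f 0, f 1, f 2, f 3)"])
    (simp add: eval_nat_numeral less_Suc_eq all_conj_distrib)

section \<open>Realising an arbitrary relation by a scheduler\<close>

definition letter :: "vec \<Rightarrow> nat \<Rightarrow> nat" where
  "letter v n = set_encode {i. i < 4 \<and> n = Suc (coord v i)}"

lemma letter_less: "letter v n < 16"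
  unfolding letter_def by (rule set_encode_less) auto

lemma encodes_letter: "encodes (letter v) v"
  unfolding encodes_def using letter_less by (auto simp: letter_def set_encode_inverse)

text \<open>A letter is allowed if it extends the past to a prefix of the canonical trace of some
  vector in \<open>R\<close>. The letter \<open>0\<close> is always added to keep the set nonempty,
  as a distribution requires.\<close>

definition next_letters :: "vec set \<Rightarrow> (nat, nat) hist \<Rightarrow> nat set" where
  "next_letters R h =
    insert 0 {a. \<exists>v\<in>R. map fst (fst h) @ [snd h, a] = map (letter v) [0..<length (fst h) + 2]}"

lemma next_letters_subset: "next_letters R h \<subseteq> {..<16}"
proof
  fix a assume "a \<in> next_letters R h"
  then consider "a = 0"
    | v where "map fst (fst h) @ [snd h, a] = map (letter v) [0..<length (fst h) + 2]"
    by (auto simp: next_letters_def)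
  then show "a \<in> {..<16}"
  proof cases
    case 2
    have "a = last (map fst (fst h) @ [snd h, a])" by simp
    also have "\<dots> = letter v (Suc (length (fst h)))" unfolding 2 by simp
    finally show ?thesis using letter_less by simp
  qed simp
qed

lemma next_letters_path_hist:
  "a \<in> next_letters R (path_hist \<tau> i) \<longleftrightarrow>
    a = 0 \<or> (\<exists>v\<in>R. (\<forall>j\<le>i. \<tau> j = letter v j) \<and> a = letter v (Suc i))"
proof -
  have "map fst (fst (path_hist \<tau> i)) @ [snd (path_hist \<tau> i), a] = map \<tau> [0..<Suc i] @ [a]"
    by (simp add: path_hist_def)
  moreover have "length (fst (path_hist \<tau> i)) = i"
    by (simp add: path_hist_def)
  ultimately show ?thesis
    by (auto simp: next_letters_def less_Suc_eq_le simp del: upt_Suc) (auto simp: le_less)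
qed

text \<open>Path quantifiers see only the support, so any distribution with this support would
  do.\<close>

definition vec_sched :: "vec set \<Rightarrow> (nat, nat) sched" where
  "vec_sched R h = pmf_of_set (next_letters R h)"

lemma set_pmf_vec_sched: "set_pmf (vec_sched R h) = next_letters R h"
  unfolding vec_sched_def
proof (rule set_pmf_of_set)
  show "finite (next_letters R h)"
    by (rule finite_subset[OF next_letters_subset]) simp
qed (simp add: next_letters_def)

lemma vec_sched_Sched: "vec_sched R \<in> Sched subset_mdp"
  using enabled_subset_mdp next_letters_subset
  by (fastforce simp: Sched_def histories_def set_pmf_vec_sched)

text \<open>Limits of prefixes and added letters \<open>0\<close> create no new vector: a trace that
  encodes a vector has a last nonempty letter, and up to there it follows the canonical trace of one
  member of \<open>R\<close>.\<close>

lemma encoded_vecs_vec_sched: "encoded_vecs (vec_sched R) = R"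
proof (intro equalityI subsetI)
  fix v assume "v \<in> R"
  have "letter v 0 = 0" by (simp add: letter_def)
  with \<open>v \<in> R\<close> have "letter v \<in> traces (vec_sched R)"
    by (auto simp: traces_def set_pmf_vec_sched next_letters_path_hist)
  then show "v \<in> encoded_vecs (vec_sched R)"
    unfolding encoded_vecs_def using encodes_letter by blast
next
  fix v assume "v \<in> encoded_vecs (vec_sched R)"
  then obtain \<tau> where \<tau>: "\<tau> \<in> traces (vec_sched R)" "encodes \<tau> v"
    by (auto simp: encoded_vecs_def)
  \<comment> \<open>All atoms have occurred by position \<open>Suc N\<close>, and at least one
    occurs there.\<close>
  define N where "N = Max (coord v ` {..<4})"
  have "N \<in> coord v ` {..<4}" unfolding N_def by (rule Max_in) (auto simp: lessThan_empty_iff)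
  then obtain k where k: "k < 4" "coord v k = N" by auto
  have N: "coord v i \<le> N" if "i < 4" for i
    unfolding N_def using that by simp
  have "k \<in> label subset_mdp (\<tau> (Suc N))"
    using \<tau>(2) k by (simp add: encodes_def)
  \<comment> \<open>A nonempty letter cannot be the added \<open>0\<close>, so it comes from a
    vector in \<open>R\<close> that agrees with the entire past.\<close>
  then have "\<tau> (Suc N) \<noteq> 0" by (intro notI) simp
  moreover have "\<tau> (Suc N) \<in> next_letters R (path_hist \<tau> N)"
    using \<tau>(1) by (simp add: traces_def set_pmf_vec_sched)
  ultimately obtain w where w: "w \<in> R" "\<forall>j\<le>N. \<tau> j = letter w j" "\<tau> (Suc N) = letter w (Suc N)"
    by (auto simp: next_letters_path_hist)
  have "coord v i = coord w i" if "i < 4" for i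
  proof -
    have "i \<in> label subset_mdp (\<tau> (Suc (coord v i)))"
      using \<tau>(2) that by (simp add: encodes_def)
    also have "\<tau> (Suc (coord v i)) = letter w (Suc (coord v i))"
      using w N[OF that] by (metis Suc_leI le_neq_implies_less)
    finally show ?thesis
      using encodes_letter[of w] that by (simp add: encodes_def)
  qed
  then have "v = w" by (rule vec_eqI)
  with w(1) show "v \<in> R" by simp
qed


section \<open>Rules as HyperCTL* formulas\<close>

abbreviation atom :: "nat \<Rightarrow> nat \<Rightarrow> nat hctl" where
  "atom i k \<equiv> HAtom i (PVar k 0)"

text \<open>Truth mentions the path \<open>k\<close> because the syntax has no closed formula without quantifiers.\<close>

definition top_form :: "nat \<Rightarrow> nat hctl" where
  "top_form k = HNot (HAnd (atom 0 k) (HNot (atom 0 k)))"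

definition ev_form :: "nat \<Rightarrow> nat hctl \<Rightarrow> nat hctl" where
  "ev_form k = HUntil (top_form k)"

definition once_form :: "nat \<Rightarrow> nat \<Rightarrow> nat hctl" where
  "once_form i k =
    HAnd (ev_form k (atom i k)) (HNot (ev_form k (HAnd (atom i k) (HNext (ev_form k (atom i k))))))"

definition vec_form :: "nat \<Rightarrow> nat hctl" where
  "vec_form k =
    HAnd (once_form 0 k) (HAnd (once_form 1 k) (HAnd (once_form 2 k) (once_form 3 k)))"

text \<open>Since each atom occurs once, a common position of two atoms expresses an equation
  between coordinates. Constants need \<open>Suc c\<close> steps because coordinate \<open>0\<close>
  is encoded at position \<open>1\<close>; in references this shift cancels.\<close>

primrec entry_form :: "nat \<Rightarrow> nat \<Rightarrow> entry \<Rightarrow> nat hctl" where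
  "entry_form k j Any = top_form k"
| "entry_form k j (Cst c) = (HNext ^^ Suc c) (atom j k)"
| "entry_form k j (Ref p i c) = ev_form k (HAnd (atom i p) ((HNext ^^ c) (atom j k)))"

primrec row_form :: "nat \<Rightarrow> nat \<Rightarrow> row \<Rightarrow> nat hctl" where
  "row_form k j [] = top_form k"
| "row_form k j (e # r) = HAnd (entry_form k j e) (row_form k (Suc j) r)"

definition fact_form :: "nat \<Rightarrow> row \<Rightarrow> nat hctl" where
  "fact_form k r = HAnd (vec_form k) (row_form k 0 r)"

text \<open>Path \<open>k\<close> carries the vector of the \<open>k\<close>-th premise, and the
  conclusion gets the next free path.\<close>

primrec rule_form :: "nat \<Rightarrow> row list \<Rightarrow> row \<Rightarrow> nat hctl" where
  "rule_form k [] r = HNot (HAll (PVar k 0) (HNot (fact_form k r)))"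
| "rule_form k (p # ps) r =
    HAll (PVar k 0) (HNot (HAnd (fact_form k p) (HNot (rule_form (Suc k) ps r))))"

primrec rules_form :: "(row list \<times> row) list \<Rightarrow> nat hctl" where
  "rules_form [] = HAll (PVar 0 0) (top_form 0)"
| "rules_form (r # rs) = HAnd (rule_form 0 (fst r) (snd r)) (rules_form rs)"

text \<open>The number \<open>n\<close> enters only through one iterated next operator outside the
  fixed fact, which keeps the code easy to compute from \<open>n\<close>.\<close>

definition not_halt_form :: "nat \<Rightarrow> nat hctl" where
  "not_halt_form n =
    HAll (PVar 0 0) (HNot (HAnd (fact_form 0 [Tag THalt]) (entry_form 0 1 (Cst n))))"

definition halting_phl :: "recf \<Rightarrow> nat \<Rightarrow> nat phl" where
  "halting_phl f n =
    PAll 0 (PHyper (HNot (HAnd (rules_form (program_rules f)) (not_halt_form n))))"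

section \<open>Syntactic side conditions: bound variables and the four atoms\<close>

primrec entry_wf :: "nat \<Rightarrow> entry \<Rightarrow> bool" where
  "entry_wf k Any \<longleftrightarrow> True"
| "entry_wf k (Cst c) \<longleftrightarrow> True"
| "entry_wf k (Ref p i c) \<longleftrightarrow> p < k \<and> i < 4"

primrec row_wf :: "nat \<Rightarrow> nat \<Rightarrow> row \<Rightarrow> bool" where
  "row_wf k j [] \<longleftrightarrow> True"
| "row_wf k j (e # r) \<longleftrightarrow> j < 4 \<and> entry_wf k e \<and> row_wf k (Suc j) r"

primrec rule_wf :: "nat \<Rightarrow> row list \<Rightarrow> row \<Rightarrow> bool" where
  "rule_wf k [] r \<longleftrightarrow> row_wf k 0 r"
| "rule_wf k (p # ps) r \<longleftrightarrow> row_wf k 0 p \<and> rule_wf (Suc k) ps r"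

definition rules_wf :: "(row list \<times> row) list \<Rightarrow> bool" where
  "rules_wf rs \<longleftrightarrow> (\<forall>(ps, r)\<in>set rs. rule_wf 0 ps r)"

lemma rules_wf_simps [simp]:
  "rules_wf []"
  "rules_wf ((ps, r) # rs) \<longleftrightarrow> rule_wf 0 ps r \<and> rules_wf rs"
  "rules_wf (rs @ rs') \<longleftrightarrow> rules_wf rs \<and> rules_wf rs'"
  "rules_wf (concat rss) \<longleftrightarrow> (\<forall>rs\<in>set rss. rules_wf rs)"
  by (auto simp: rules_wf_def)

lemma rules_wf_program_rules: "rules_wf (program_rules f)"
proof -
  have proj: "rules_wf (proj_rules i)" for i
    by (induction i) simp_all
  have list: "rules_wf (list_rules gs)" for gs
    by (induction gs) simp_all
  have "rules_wf (rules f)"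
    by (induction f) (simp_all add: proj list)
  then show ?thesis
    by (simp add: program_rules_def cons_rules_def)
qed

lemma hctl_free_next [simp]: "hctl_free ((HNext ^^ n) \<xi>) = hctl_free \<xi>"
  by (induction n) simp_all

lemma hctl_aps_next [simp]: "hctl_aps ((HNext ^^ n) \<xi>) = hctl_aps \<xi>"
  by (induction n) simp_all

lemma hctl_scheds_next [simp]: "hctl_scheds ((HNext ^^ n) \<xi>) = hctl_scheds \<xi>"
  by (induction n) simp_all

lemmas hctl_form_defs = top_form_def ev_form_def once_form_def vec_form_def

lemma entry_form_syntax:
  assumes "entry_wf k e" "j < 4"
  shows "hctl_free (entry_form k j e) \<subseteq> {PVar i 0 |i. i \<le> k}" "hctl_aps (entry_form k j e) \<subseteq> {..<4}"
    "hctl_scheds (entry_form k j e) = {}"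
  using assms by (cases e; auto simp: hctl_form_defs simp del: funpow.simps)+

lemma row_form_syntax:
  assumes "row_wf k j r"
  shows "hctl_free (row_form k j r) \<subseteq> {PVar i 0 |i. i \<le> k}" "hctl_aps (row_form k j r) \<subseteq> {..<4}"
    "hctl_scheds (row_form k j r) = {}"
  using assms entry_form_syntax
  by (induction r arbitrary: j; simp add: hctl_form_defs; blast)+

lemma fact_form_syntax:
  assumes "row_wf k 0 r"
  shows "hctl_free (fact_form k r) \<subseteq> {PVar i 0 |i. i \<le> k}" "hctl_aps (fact_form k r) \<subseteq> {..<4}"
    "hctl_scheds (fact_form k r) = {}"
  using row_form_syntax[OF assms] by (auto simp: fact_form_def hctl_form_defs)

lemma rule_form_syntax:
  assumes "rule_wf k ps r"
  shows "hctl_free (rule_form k ps r) \<subseteq> {PVar i 0 |i. i < k}" "hctl_aps (rule_form k ps r) \<subseteq> {..<4}"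
    "hctl_scheds (rule_form k ps r) \<subseteq> {0}"
proof -
  have le: "{PVar i 0 |i. i \<le> k} - {PVar k 0} \<subseteq> {PVar i 0 |i. i < k}" for k
    by (auto simp: le_less)
  have "hctl_free (rule_form k ps r) \<subseteq> {PVar i 0 |i. i < k} \<and>
      hctl_aps (rule_form k ps r) \<subseteq> {..<4} \<and> hctl_scheds (rule_form k ps r) \<subseteq> {0}"
    using assms
  proof (induction ps arbitrary: k)
    case Nil
    then show ?case
      using fact_form_syntax[of k r] le[of k] by auto
  next
    case (Cons p ps)
    have "hctl_free (rule_form (Suc k) ps r) \<subseteq> {PVar i 0 |i. i \<le> k}"
      "hctl_aps (rule_form (Suc k) ps r) \<subseteq> {..<4}" "hctl_scheds (rule_form (Suc k) ps r) \<subseteq> {0}"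
      using Cons.IH[of "Suc k"] Cons.prems by (simp_all add: less_Suc_eq_le)
    then show ?case
      using Cons.prems fact_form_syntax[of k p] le[of k] by auto
  qed
  then show "hctl_free (rule_form k ps r) \<subseteq> {PVar i 0 |i. i < k}"
    "hctl_aps (rule_form k ps r) \<subseteq> {..<4}" "hctl_scheds (rule_form k ps r) \<subseteq> {0}"
    by auto
qed

lemma rules_form_syntax:
  assumes "rules_wf rs"
  shows "hctl_free (rules_form rs) = {}" "hctl_aps (rules_form rs) \<subseteq> {..<4}"
    "hctl_scheds (rules_form rs) \<subseteq> {0}"
proof -
  have "hctl_free (rules_form rs) = {} \<and> hctl_aps (rules_form rs) \<subseteq> {..<4} \<and>
      hctl_scheds (rules_form rs) \<subseteq> {0}"
    using assms
  proof (induction rs)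
    case Nil
    show ?case by (auto simp: hctl_form_defs)
  next
    case (Cons r rs)
    obtain ps q where r: "r = (ps, q)" by force
    show ?case
      using Cons rule_form_syntax[of 0 ps q] unfolding r by auto
  qed
  then show "hctl_free (rules_form rs) = {}" "hctl_aps (rules_form rs) \<subseteq> {..<4}"
    "hctl_scheds (rules_form rs) \<subseteq> {0}"
    by auto
qed

lemma halting_instance: "(subset_table, halting_phl f n) \<in> phl_instances"
proof -
  have "hctl_free (not_halt_form n) = {}" "hctl_aps (not_halt_form n) \<subseteq> {..<4}"
    "hctl_scheds (not_halt_form n) \<subseteq> {0}"
    using fact_form_syntax[of 0 "[Tag THalt]"]
    by (auto simp: not_halt_form_def simp del: funpow.simps)
  with rules_form_syntax[OF rules_wf_program_rules[of f]] show ?thesis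
    by (auto simp: phl_instances_def halting_phl_def valid_subset_table well_formed_def
        closed_phl_def subset_table_def[THEN arg_cong, of naps])
qed

section \<open>Semantics of the formulas over traces\<close>

definition path_assignment :: "(nat \<Rightarrow> nat) list \<Rightarrow> nat path_assignment" where
  "path_assignment \<tau>s = map (\<lambda>k. (PVar k 0, \<tau>s ! k)) [0..<length \<tau>s]"

abbreviation sat :: "(nat, nat) sched \<Rightarrow> (nat \<Rightarrow> nat) list \<Rightarrow> nat hctl \<Rightarrow> bool" where
  "sat \<SS> \<tau>s \<equiv> hctl_sat subset_mdp [(0, \<SS>)] (path_assignment \<tau>s)"

definition shift :: "nat \<Rightarrow> (nat \<Rightarrow> nat) list \<Rightarrow> (nat \<Rightarrow> nat) list" where
  "shift n = map (\<lambda>\<tau> i. \<tau> (i + n))"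

lemma shift_simps [simp]:
  "length (shift n \<tau>s) = length \<tau>s"
  "k < length \<tau>s \<Longrightarrow> (shift n \<tau>s ! k) i = (\<tau>s ! k) (i + n)"
  "shift m (shift n \<tau>s) = shift (m + n) \<tau>s"
  "shift 0 \<tau>s = \<tau>s"
  by (simp_all add: shift_def ac_simps)

lemma shift_paths_assignment:
  "shift_paths n (path_assignment \<tau>s) = path_assignment (shift n \<tau>s)"
  by (simp add: shift_paths_def path_assignment_def shift_def)

lemma path_assignment_snoc:
  "path_assignment \<tau>s @ [(PVar (length \<tau>s) 0, \<tau>)] = path_assignment (\<tau>s @ [\<tau>])"
  by (simp add: path_assignment_def nth_append)

lemma assigned_path_assignment:
  assumes "k < length \<tau>s"
  shows "assigned (path_assignment \<tau>s) (PVar k 0) = \<tau>s ! k"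
proof -
  have "{i. i < length (path_assignment \<tau>s) \<and> fst (path_assignment \<tau>s ! i) = PVar k 0} = {k}"
    using assms by (auto simp: path_assignment_def)
  then show ?thesis
    using assms by (simp add: assigned_def last_pos_def path_assignment_def)
qed

lemma sat_atom: "k < length \<tau>s \<Longrightarrow> sat \<SS> \<tau>s (atom i k) \<longleftrightarrow> i \<in> label subset_mdp ((\<tau>s ! k) 0)"
  by (simp add: assigned_path_assignment)

lemma sat_next: "sat \<SS> \<tau>s (HNext \<xi>) \<longleftrightarrow> sat \<SS> (shift 1 \<tau>s) \<xi>"
  by (simp add: shift_paths_assignment)

lemma sat_next_iterate: "sat \<SS> \<tau>s ((HNext ^^ n) \<xi>) \<longleftrightarrow> sat \<SS> (shift n \<tau>s) \<xi>"
  by (induction n arbitrary: \<tau>s) (simp_all add: shift_paths_assignment)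

lemma sat_top: "sat \<SS> \<tau>s (top_form k)"
  by (simp add: top_form_def)

lemma sat_ev: "sat \<SS> \<tau>s (ev_form k \<xi>) \<longleftrightarrow> (\<exists>n. sat \<SS> (shift n \<tau>s) \<xi>)"
  by (simp add: ev_form_def shift_paths_assignment sat_top)

text \<open>All paths start in state \<open>0\<close>, so nested quantifiers do not restart the chain elsewhere.\<close>

lemma quantified_chain_zero:
  assumes "\<And>\<tau>. \<tau> \<in> set \<tau>s \<Longrightarrow> \<tau> 0 = 0"
  shows "quantified_chain subset_mdp [(0, \<SS>)] (path_assignment \<tau>s) 0 = induced subset_mdp \<SS>"
proof -
  have S: "assigned [(0 :: svar, \<SS>)] 0 = \<SS>"
  proof -
    have "last_pos [(0 :: svar, \<SS>)] 0 = Max {0}"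
      unfolding last_pos_def by (rule arg_cong[of _ _ Max]) auto
    then show ?thesis by (simp add: assigned_def)
  qed
  have \<Theta>: "map (\<lambda>(\<pi>, \<rho>). (psched \<pi>, \<rho>)) (path_assignment \<tau>s) = map (Pair 0) \<tau>s"
    by (rule nth_equalityI) (auto simp: path_assignment_def)
  have "assigned (map (Pair (0::nat)) \<tau>s) 0 \<in> set \<tau>s" if "\<tau>s \<noteq> []"
  proof -
    let ?I = "{i. i < length \<tau>s}"
    have "last_pos (map (Pair (0::nat)) \<tau>s) 0 = Max ?I"
      unfolding last_pos_def by (rule arg_cong[of _ _ Max]) auto
    moreover have "Max ?I \<in> ?I"
      using that by (intro Max_in) auto
    ultimately show ?thesis
      by (simp add: assigned_def)
  qed
  then have "\<tau>s \<noteq> [] \<Longrightarrow> assigned (map (Pair (0::nat)) \<tau>s) 0 0 = 0"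
    using assms by blast
  then show ?thesis
    unfolding quantified_chain_def S \<Theta> Let_def
    by (cases "\<tau>s = []") (simp_all add: induced_def embed_pmf_iprob)
qed

lemma sat_All:
  assumes "\<SS> \<in> Sched subset_mdp" "set \<tau>s \<subseteq> traces \<SS>" "k = length \<tau>s"
  shows "sat \<SS> \<tau>s (HAll (PVar k 0) \<xi>) \<longleftrightarrow> (\<forall>\<tau>\<in>traces \<SS>. sat \<SS> (\<tau>s @ [\<tau>]) \<xi>)"
proof -
  have "quantified_chain subset_mdp [(0, \<SS>)] (path_assignment \<tau>s) 0 = induced subset_mdp \<SS>"
    using assms(2) by (intro quantified_chain_zero) (auto simp: traces_def)
  then show ?thesis
    unfolding traces_eq[OF assms(1), symmetric]
    by (simp add: assms(3) path_assignment_snoc)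
qed

text \<open>The left side is the meaning of \<open>once_form\<close>: some occurrence, and none
  strictly after another. As position \<open>0\<close> is excluded, the only occurrence is at a
  successor.\<close>

lemma unique_position:
  assumes "\<not> P 0"
  shows "(\<exists>n. P n) \<and> \<not> (\<exists>n m. P n \<and> P (m + Suc n)) \<longleftrightarrow> (\<exists>k. \<forall>n. P n \<longleftrightarrow> n = Suc k)"
proof
  assume *: "(\<exists>n. P n) \<and> \<not> (\<exists>n m. P n \<and> P (m + Suc n))"
  then obtain n where n: "P n" by blast
  have "\<not> P m" if "n < m" for m
    using * n that less_iff_Suc_add[of n m] by (metis add.commute add_Suc_right)
  moreover have "\<not> P m" if "m < n" for m
    using * n that less_iff_Suc_add[of m n] by (metis add.commute add_Suc_right)
  moreover obtain k where "n = Suc k"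
    using n assms by (cases n) auto
  ultimately show "\<exists>k. \<forall>n. P n \<longleftrightarrow> n = Suc k"
    using n by (metis linorder_neqE_nat)
next
  assume "\<exists>k. \<forall>n. P n \<longleftrightarrow> n = Suc k"
  then obtain k where "P = (\<lambda>n. n = Suc k)" by blast
  then show "(\<exists>n. P n) \<and> \<not> (\<exists>n m. P n \<and> P (m + Suc n))" by simp
qed

lemma sat_once:
  assumes "k < length \<tau>s" "(\<tau>s ! k) 0 = 0"
  shows "sat \<SS> \<tau>s (once_form i k) \<longleftrightarrow>
    (\<exists>m. \<forall>n. i \<in> label subset_mdp ((\<tau>s ! k) n) \<longleftrightarrow> n = Suc m)"
proof -
  have "\<not> i \<in> label subset_mdp ((\<tau>s ! k) 0)"
    using assms(2) by simp
  note unique = unique_position[of "\<lambda>n. i \<in> label subset_mdp ((\<tau>s ! k) n)", OF this]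
  have "sat \<SS> \<tau>s (once_form i k) \<longleftrightarrow>
      (\<exists>n. i \<in> label subset_mdp ((\<tau>s ! k) n)) \<and>
      \<not> (\<exists>n m. i \<in> label subset_mdp ((\<tau>s ! k) n) \<and>
        i \<in> label subset_mdp ((\<tau>s ! k) (m + Suc n)))"
    using assms(1) unfolding once_form_def hctl_sat.simps(2,3) sat_ev sat_next
    by (simp add: sat_atom del: hctl_sat.simps(1))
  then show ?thesis
    unfolding unique .
qed

lemma sat_vec_form:
  assumes "k < length \<tau>s" "(\<tau>s ! k) 0 = 0"
  shows "sat \<SS> \<tau>s (vec_form k) \<longleftrightarrow> (\<exists>v. encodes (\<tau>s ! k) v)"
proof -
  have all4: "(\<forall>i<4. P i) \<longleftrightarrow> P 0 \<and> P 1 \<and> P 2 \<and> P 3" for P :: "nat \<Rightarrow> bool"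
    by (simp add: numeral_eq_Suc All_less_Suc2)
  have "sat \<SS> \<tau>s (vec_form k) \<longleftrightarrow>
      (\<forall>i<4. \<exists>m. \<forall>n. i \<in> label subset_mdp ((\<tau>s ! k) n) \<longleftrightarrow> n = Suc m)"
    unfolding vec_form_def hctl_sat.simps(2) sat_once[OF assms] all4 ..
  also have "\<dots> \<longleftrightarrow> (\<exists>v. encodes (\<tau>s ! k) v)"
  proof
    assume "\<forall>i<4. \<exists>m. \<forall>n. i \<in> label subset_mdp ((\<tau>s ! k) n) \<longleftrightarrow> n = Suc m"
    then obtain f where f: "\<And>i n. i < 4 \<Longrightarrow> i \<in> label subset_mdp ((\<tau>s ! k) n) \<longleftrightarrow> n = Suc (f i)"
      by metis
    obtain v where "\<forall>i<4. coord v i = f i"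
      using coord_exists by blast
    with f have "encodes (\<tau>s ! k) v"
      by (simp add: encodes_def)
    then show "\<exists>v. encodes (\<tau>s ! k) v" ..
  qed (auto simp: encodes_def)
  finally show ?thesis .
qed

lemma sat_entry_form:
  assumes "list_all2 encodes \<tau>s (vs @ [v])" "entry_wf (length vs) e" "j < 4"
  shows "sat \<SS> \<tau>s (entry_form (length vs) j e) \<longleftrightarrow> entry_ok vs (coord v j) e"
proof -
  have len: "length \<tau>s = Suc (length vs)"
    using list_all2_lengthD[OF assms(1)] by simp
  have enc: "i \<in> label subset_mdp ((\<tau>s ! p) n) \<longleftrightarrow> n = Suc (coord ((vs @ [v]) ! p) i)"
    if "p \<le> length vs" "i < 4" for p i n
    using list_all2_nthD[OF assms(1), of p] that len by (auto simp: encodes_def)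
  show ?thesis
  proof (cases e)
    case Any
    then show ?thesis by (simp add: sat_top)
  next
    case (Cst c)
    then show ?thesis
      using enc[of "length vs" j] assms(3) len
      by (auto simp: sat_next_iterate sat_atom simp del: hctl_sat.simps(1) funpow.simps)
  next
    case (Ref p i c)
    then show ?thesis
      using enc[of "length vs" j] enc[of p i] assms(2,3) len
      by (auto simp: sat_ev sat_next_iterate sat_atom nth_append simp del: hctl_sat.simps(1))
  qed
qed

lemma sat_row_form:
  assumes "list_all2 encodes \<tau>s (vs @ [v])" "row_wf (length vs) j r"
  shows "sat \<SS> \<tau>s (row_form (length vs) j r) \<longleftrightarrow> row_ok vs v j r"
  using assms(2) by (induction r arbitrary: j) (simp_all add: sat_top sat_entry_form[OF assms(1)])

lemma sat_fact_form:
  assumes "list_all2 encodes \<tau>s vs" "row_wf (length vs) 0 r" "\<tau> 0 = 0" "k = length vs"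
  shows "sat \<SS> (\<tau>s @ [\<tau>]) (fact_form k r) \<longleftrightarrow> (\<exists>v. encodes \<tau> v \<and> row_ok vs v 0 r)"
proof -
  have len: "length \<tau>s = length vs"
    using list_all2_lengthD[OF assms(1)] .
  have vec: "sat \<SS> (\<tau>s @ [\<tau>]) (vec_form k) \<longleftrightarrow> (\<exists>v. encodes \<tau> v)"
    using sat_vec_form[of k "\<tau>s @ [\<tau>]" \<SS>] len assms(3,4) by (simp add: nth_append)
  have "sat \<SS> (\<tau>s @ [\<tau>]) (row_form k 0 r) \<longleftrightarrow> row_ok vs v 0 r" if "encodes \<tau> v" for v
    unfolding assms(4) using assms(1) that
    by (intro sat_row_form assms(2)) (simp add: list_all2_appendI)
  then show ?thesis
    unfolding fact_form_def hctl_sat.simps(2) vec by blast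
qed

text \<open>Quantifiers over traces become quantifiers over encoded vectors, because
  \<open>fact_form\<close> rejects every trace that encodes none.\<close>

lemma sat_rule_form:
  assumes "\<SS> \<in> Sched subset_mdp"
  shows "set \<tau>s \<subseteq> traces \<SS> \<Longrightarrow> list_all2 encodes \<tau>s vs \<Longrightarrow> k = length vs \<Longrightarrow> rule_wf k ps r \<Longrightarrow>
    sat \<SS> \<tau>s (rule_form k ps r) \<longleftrightarrow> rule_ok (encoded_vecs \<SS>) vs ps r"
proof (induction ps arbitrary: \<tau>s vs k)
  case Nil
  have k: "k = length \<tau>s"
    using list_all2_lengthD[OF Nil(2)] Nil(3) by simp
  have "sat \<SS> (\<tau>s @ [\<tau>]) (fact_form k r) \<longleftrightarrow> (\<exists>v. encodes \<tau> v \<and> row_ok vs v 0 r)"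
    if "\<tau> \<in> traces \<SS>" for \<tau>
    using that Nil by (intro sat_fact_form) (auto simp: traces_def)
  then show ?case
    unfolding rule_form.simps rule_ok.simps hctl_sat.simps(3) sat_All[OF assms Nil(1) k]
      encoded_vecs_def
    by blast
next
  case (Cons p ps)
  have k: "k = length \<tau>s"
    using list_all2_lengthD[OF Cons.prems(2)] Cons.prems(3) by simp
  have fact: "sat \<SS> (\<tau>s @ [\<tau>]) (fact_form k p) \<longleftrightarrow> (\<exists>v. encodes \<tau> v \<and> row_ok vs v 0 p)"
    if "\<tau> \<in> traces \<SS>" for \<tau>
    using that Cons.prems by (intro sat_fact_form) (auto simp: traces_def)
  have IH: "sat \<SS> (\<tau>s @ [\<tau>]) (rule_form (Suc k) ps r) \<longleftrightarrow>
      rule_ok (encoded_vecs \<SS>) (vs @ [v]) ps r"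
    if "\<tau> \<in> traces \<SS>" "encodes \<tau> v" for \<tau> v
    using that Cons.prems by (intro Cons.IH) (auto simp: list_all2_appendI)
  show ?case
    unfolding rule_form.simps rule_ok.simps hctl_sat.simps(2,3) sat_All[OF assms Cons.prems(1) k]
      encoded_vecs_def
    using fact IH[unfolded encoded_vecs_def] by blast
qed

lemma sat_rules_form:
  assumes "\<SS> \<in> Sched subset_mdp" "rules_wf rs"
  shows "sat \<SS> [] (rules_form rs) \<longleftrightarrow> closed_under (encoded_vecs \<SS>) rs"
  using assms(2)
proof (induction rs)
  case Nil
  show ?case
    using sat_All[OF assms(1), of "[]"] by (simp add: sat_top del: hctl_sat.simps(6))
next
  case (Cons r rs)
  obtain ps q where r: "r = (ps, q)" by force
  show ?case
    using Cons sat_rule_form[OF assms(1), of "[]" "[]" 0 ps q] by (simp add: r)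
qed

lemma sat_not_halt_form:
  assumes "\<SS> \<in> Sched subset_mdp"
  shows "sat \<SS> [] (not_halt_form n) \<longleftrightarrow> \<not> (\<exists>b c. (to_nat THalt, n, b, c) \<in> encoded_vecs \<SS>)"
proof -
  have fact: "sat \<SS> [\<tau>] (fact_form 0 [Tag THalt]) \<longleftrightarrow> (\<exists>v. encodes \<tau> v \<and> coord v 0 = to_nat THalt)"
    if "\<tau> \<in> traces \<SS>" for \<tau>
    using sat_fact_form[of "[]" "[]" "[Tag THalt]" \<tau> 0 \<SS>] that by (simp add: traces_def)
  have entry: "sat \<SS> [\<tau>] (entry_form 0 1 (Cst n)) \<longleftrightarrow> coord v 1 = n" if "encodes \<tau> v" for \<tau> v
    using sat_entry_form[of "[\<tau>]" "[]" v "Cst n" 1 \<SS>] that by simp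
  have "sat \<SS> [] (not_halt_form n) \<longleftrightarrow> (\<forall>\<tau>\<in>traces \<SS>.
      \<not> (sat \<SS> [\<tau>] (fact_form 0 [Tag THalt]) \<and> sat \<SS> [\<tau>] (entry_form 0 1 (Cst n))))"
    unfolding not_halt_form_def by (subst sat_All[OF assms]) (simp_all del: entry_form.simps)
  also have "\<dots> \<longleftrightarrow>
      \<not> (\<exists>v\<in>encoded_vecs \<SS>. coord v 0 = to_nat THalt \<and> coord v 1 = n)"
    unfolding encoded_vecs_def using fact entry by blast
  finally show ?thesis
    by (simp add: split_vec)
qed

text \<open>If the program halts, every closed relation contains the halting fact. Conversely, the
  scheduler realising the standard model is one instance of the quantifier, and its halting facts
  are true.\<close>

lemma halting_phl_models: "phl_models subset_mdp (halting_phl f n) \<longleftrightarrow> (\<exists>y. rec_eval f [n] y)"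
proof -
  have "phl_models subset_mdp (halting_phl f n) \<longleftrightarrow>
      (\<forall>\<SS>\<in>Sched subset_mdp. \<not> (sat \<SS> [] (rules_form (program_rules f)) \<and> sat \<SS> [] (not_halt_form n)))"
    by (simp add: phl_models_def halting_phl_def path_assignment_def)
  also have "\<dots> \<longleftrightarrow> (\<forall>\<SS>\<in>Sched subset_mdp. closed_under (encoded_vecs \<SS>) (program_rules f) \<longrightarrow>
      (\<exists>b c. (to_nat THalt, n, b, c) \<in> encoded_vecs \<SS>))"
    by (simp add: sat_rules_form rules_wf_program_rules sat_not_halt_form)
  also have "\<dots> \<longleftrightarrow> (\<exists>y. rec_eval f [n] y)"
  proof
    assume "\<forall>\<SS>\<in>Sched subset_mdp. closed_under (encoded_vecs \<SS>) (program_rules f) \<longrightarrow>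
      (\<exists>b c. (to_nat THalt, n, b, c) \<in> encoded_vecs \<SS>)"
    from bspec[OF this vec_sched_Sched[of "standard_model f"]]
    show "\<exists>y. rec_eval f [n] y"
      by (simp add: encoded_vecs_vec_sched standard_model_program_rules)
  qed (auto dest: program_rules_sound)
  finally show ?thesis .
qed

section \<open>Diagonalisation\<close>

lemma hctl_code_next:
  "hctl_code ((HNext ^^ n) \<xi>) = ((\<lambda>c. list_encode [3, c]) ^^ n) (hctl_code \<xi>)"
  by (induction n) simp_all

definition program_code :: "recf \<Rightarrow> nat" where
  "program_code f = hctl_code (rules_form (program_rules f))"

text \<open>
  The program's number is the code of the subformula describing it, so the code of the diagonal
  instance arises from it by pairing and iteration, without decoding the program.
\<close>

lemma diagonal_code_computable:
  "\<exists>F. computable F \<and>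
    (\<forall>f. F (program_code f) = instance_code (subset_table, halting_phl f (program_code f)))"
proof -
  define a where "a = hctl_code (fact_form 0 [Tag THalt])"
  \<comment> \<open>The entry for the constant \<open>x\<close> has \<open>Suc x\<close> next
    operators: one is placed in \<open>b\<close>, the others come from the iteration in
    \<open>halt\<close>.\<close>
  define b where "b = hctl_code (HNext (atom 1 0))"
  define halt where "halt x = ((\<lambda>c. list_encode [3, c]) ^^ x) b" for x
  \<comment> \<open>The nested lists spell out the code of \<open>halting_phl\<close>, with
    \<open>x\<close> used both as the code of the rules formula and as the input number.\<close>
  define F where "F x = prod_encode (table_code subset_table, list_encode [0, 0, list_encode [3,
    list_encode [2, list_encode [1, x, list_encode [5, 0, 0, list_encode [2,
      list_encode [1, a, halt x]]]]]]])" for x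
  have "computable F"
    unfolding F_def halt_def list_encode.simps
    by (intro computable_intros)
  moreover have "F (program_code f) = instance_code (subset_table, halting_phl f (program_code f))"
    for f
    unfolding F_def a_def halt_def b_def
    by (simp add: instance_code_def halting_phl_def not_halt_form_def hctl_code_next
        program_code_def funpow_swap1
        del: list_encode.simps)
  ultimately show ?thesis
    by blast
qed

theorem theorem1:
  shows "\<not> decidable_on phl_instances instance_code (\<lambda>(D, \<Phi>). phl_models (table_mdp D) \<Phi>)"
proof
  assume "decidable_on phl_instances instance_code (\<lambda>(D, \<Phi>). phl_models (table_mdp D) \<Phi>)"
  then obtain d where d: "\<And>D \<Phi>. (D, \<Phi>) \<in> phl_instances \<Longrightarrow>
      rec_eval d [instance_code (D, \<Phi>)] (if phl_models (table_mdp D) \<Phi> then 1 else 0)"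
    unfolding decidable_on_def by fastforce
  obtain F r where F: "\<And>f. F (program_code f) =
      instance_code (subset_table, halting_phl f (program_code f))"
    and r: "\<And>x. rec_eval r [x] (F x)"
    using diagonal_code_computable unfolding computable_def by blast
  \<comment> \<open>The search body ignores the search index and asks \<open>d\<close> about
    \<open>F x\<close>: answer \<open>0\<close> stops the search at once, and answer
    \<open>1\<close> makes it diverge. Hence \<open>q\<close> does the opposite of what
    \<open>d\<close> predicts.\<close>
  define q where "q = Mu (Comp d [Comp r [Proj 1]])"
  \<comment> \<open>On this input the instance \<open>F x\<close> asks whether \<open>q\<close>
    halts on \<open>x\<close> itself.\<close>
  define x where "x = program_code q"
  have body: "rec_eval (Comp d [Comp r [Proj 1]]) [i, x] y" if "rec_eval d [F x] y" for i y
  proof -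
    have "rec_eval (Proj 1) [i, x] x" by (rule rec_eval_Proj) auto
    from rec_eval_Comp1[OF rec_eval_Comp1[OF this r] that] show ?thesis .
  qed
  have Fx: "F x = instance_code (subset_table, halting_phl q x)"
    using F[of q] by (simp add: x_def)
  have dx: "rec_eval d [F x] (if \<exists>y. rec_eval q [x] y then 1 else 0)"
    using d[OF halting_instance, of q x] by (simp only: Fx halting_phl_models)
  show False
  proof (cases "\<exists>y. rec_eval q [x] y")
    case True
    then obtain y where "rec_eval (Comp d [Comp r [Proj 1]]) [y, x] 0"
      unfolding q_def by (auto elim: rec_eval_elims(7))
    moreover have "rec_eval (Comp d [Comp r [Proj 1]]) [y, x] 1"
      using dx True by (intro body) simp
    ultimately show False
      using rec_eval_deterministic by fastforce
  next
    case False
    then have "rec_eval (Comp d [Comp r [Proj 1]]) [0, x] 0"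
      using dx by (intro body) simp
    then have "rec_eval q [x] 0"
      unfolding q_def by (rule rec_eval.Mu) simp
    with False show False by blast
  qed
qed

end
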